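(* Let $G=(V,E)$ be an undirected graph with nonnegative edge costs $c$, and let $R\subseteq V$ be the set of terminals. Let $\mathrm{OPT}$ denote the minimum cost of a Steiner tree, and let $\mathrm{LP}^*$ denote the optimal value of the hypergraphic linear program \[ \min \sum_K C_K x_K \quad\text{s.t.}\quad \sum_{K:\,K\cap S\neq\varnothing} x_K(|K\cap S|-1)\le |S|-1\ \ \forall\, \varnothing\neq S\subseteq R,\qquad \sum_K x_K(|K|-1)=|R|-1,\qquad x_K\ge 0\ \ \forall K. \] Then $\mathrm{OPT}\le \left(1+\tfrac{\ln 3}{2}\right)\mathrm{LP}^*$. That is, the integrality gap of this relaxation (the supremum over all instances of $\mathrm{OPT}/\mathrm{LP}^*$) is at most $1+\frac{\ln 3}{2}\approx 1.55$.
   Context: A Steiner tree is a tree in $G$ containing all vertices of $R$ (plus possibly some vertices of $V\setminus R$, called Steiner vertices). For a set $K\subseteq R$ of terminals with $|K|\ge 2$, a full component on $K$ is a tree in $G$ whose leaf set is exactly $K$ and whose internal vertices are all Steiner vertices. $C_K$ is the minimum cost of a full component on $K$; the variables $x_K$ range over those $K\subseteq R$, $|K|\ge 2$, for which a full component on $K$ exists. *)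

theory Defs
  imports Complex_Main
begin

text \<open>Simple undirected graph: finite vertex set V, edges are 2-element subsets of V.\<close>
definition graph :: "'a set \<Rightarrow> 'a set set \<Rightarrow> bool" where
  "graph V E \<longleftrightarrow> finite V \<and> (\<forall>e\<in>E. \<exists>u v. u \<in> V \<and> v \<in> V \<and> u \<noteq> v \<and> e = {u, v})"

definition connected_sub :: "'a set \<Rightarrow> 'a set set \<Rightarrow> bool" where
  "connected_sub VT ET \<longleftrightarrow>
     (\<forall>u\<in>VT. \<forall>v\<in>VT. (u, v) \<in> {(a, b). {a, b} \<in> ET}\<^sup>*)"

text \<open>A tree in G: a nonempty connected subgraph (VT, ET) of G with |ET| = |VT| - 1.\<close>
definition is_tree :: "'a set \<Rightarrow> 'a set set \<Rightarrow> 'a set \<Rightarrow> 'a set set \<Rightarrow> bool" where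
  "is_tree V E VT ET \<longleftrightarrow> VT \<subseteq> V \<and> ET \<subseteq> E \<and> (\<forall>e\<in>ET. e \<subseteq> VT) \<and> VT \<noteq> {}
     \<and> connected_sub VT ET \<and> card ET + 1 = card VT"

definition degree :: "'a set set \<Rightarrow> 'a \<Rightarrow> nat" where
  "degree ET v = card {e \<in> ET. v \<in> e}"

definition leaves :: "'a set \<Rightarrow> 'a set set \<Rightarrow> 'a set" where
  "leaves VT ET = {v \<in> VT. degree ET v = 1}"

definition tree_cost :: "('a set \<Rightarrow> real) \<Rightarrow> 'a set set \<Rightarrow> real" where
  "tree_cost c ET = (\<Sum>e\<in>ET. c e)"

definition steiner_tree :: "'a set \<Rightarrow> 'a set set \<Rightarrow> 'a set \<Rightarrow> 'a set \<Rightarrow> 'a set set \<Rightarrow> bool" where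
  "steiner_tree V E R VT ET \<longleftrightarrow> is_tree V E VT ET \<and> R \<subseteq> VT"

text \<open>Full component on K: tree whose leaf set is exactly K, all other vertices Steiner vertices.\<close>
definition full_component :: "'a set \<Rightarrow> 'a set set \<Rightarrow> 'a set \<Rightarrow> 'a set \<Rightarrow> 'a set \<Rightarrow> 'a set set \<Rightarrow> bool" where
  "full_component V E R K VT ET \<longleftrightarrow> is_tree V E VT ET \<and> leaves VT ET = K \<and> (VT - K) \<inter> R = {}"

definition OPT :: "'a set \<Rightarrow> 'a set set \<Rightarrow> ('a set \<Rightarrow> real) \<Rightarrow> 'a set \<Rightarrow> real" where
  "OPT V E c R = Inf {tree_cost c ET | VT ET. steiner_tree V E R VT ET}"

text \<open>Index set of LP variables: K \<subseteq> R, |K| \<ge> 2, a full component on K exists.\<close>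
definition comps :: "'a set \<Rightarrow> 'a set set \<Rightarrow> 'a set \<Rightarrow> 'a set set" where
  "comps V E R = {K. K \<subseteq> R \<and> card K \<ge> 2 \<and> (\<exists>VT ET. full_component V E R K VT ET)}"

definition CK :: "'a set \<Rightarrow> 'a set set \<Rightarrow> ('a set \<Rightarrow> real) \<Rightarrow> 'a set \<Rightarrow> 'a set \<Rightarrow> real" where
  "CK V E c R K = Inf {tree_cost c ET | VT ET. full_component V E R K VT ET}"

definition lp_feasible :: "'a set \<Rightarrow> 'a set set \<Rightarrow> 'a set \<Rightarrow> ('a set \<Rightarrow> real) \<Rightarrow> bool" where
  "lp_feasible V E R x \<longleftrightarrow>
     (\<forall>K\<in>comps V E R. x K \<ge> 0)
   \<and> (\<forall>S. S \<subseteq> R \<and> S \<noteq> {} \<longrightarrow>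
        (\<Sum>K\<in>{K \<in> comps V E R. K \<inter> S \<noteq> {}}. x K * (real (card (K \<inter> S)) - 1))
          \<le> real (card S) - 1)
   \<and> (\<Sum>K\<in>comps V E R. x K * (real (card K) - 1)) = real (card R) - 1"

definition lp_obj :: "'a set \<Rightarrow> 'a set set \<Rightarrow> ('a set \<Rightarrow> real) \<Rightarrow> 'a set \<Rightarrow> ('a set \<Rightarrow> real) \<Rightarrow> real" where
  "lp_obj V E c R x = (\<Sum>K\<in>comps V E R. CK V E c R K * x K)"

definition LP_star :: "'a set \<Rightarrow> 'a set set \<Rightarrow> ('a set \<Rightarrow> real) \<Rightarrow> 'a set \<Rightarrow> real" where
  "LP_star V E c R = Inf {lp_obj V E c R x | x. lp_feasible V E R x}"

end

theory Submission
  imports Defs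
begin

text \<open>This is the loss-contracting argument of Chakrabarty, Koenemann and Pritchard. Keep a set of links
  connecting the terminals. By the bridge inequality, contracting a component \<open>K\<close> saves on average, under
  the weights \<open>x K\<close> of a feasible solution, at least the cost of a cheapest set of links. Buying
  only the loss of \<open>K\<close> (edges that join its branching vertices to terminals, at most half of
  its cost) turns the remaining edges of \<open>K\<close> into new links. After \<open>n\<close> averaged steps with
  step weight \<open>1 / M\<close>, where \<open>n / M = ln 3\<close>, the initial links (of cost at most twice the LP
  value) count only with weight \<open>(1 - 1 / M) ^ n \<le> 1 / 3\<close>, and the losses bought amount
  to \<open>ln 3\<close> times the fractional loss, which is at most half the LP value.\<close>

section \<open>The bridge inequality\<close>

text \<open>For symmetric \<open>A\<close> this is the class of \<open>x\<close> under the
  equivalence \<open>A\<^sup>*\<close>. A partition of the terminals is represented by a relation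
  that generates it, so that contracting a set is a union of relations.\<close>

definition comp_of :: "('a \<times> 'a) set \<Rightarrow> 'a \<Rightarrow> 'a set" where
  "comp_of A x = A\<^sup>* `` {x}"

lemma comp_of_eq_iff:
  assumes "sym A"
  shows "comp_of A x = comp_of A y \<longleftrightarrow> (x, y) \<in> A\<^sup>*"
proof -
  have s: "sym (A\<^sup>*)" using assms by (rule sym_rtrancl)
  show ?thesis
    unfolding comp_of_def
    by (auto dest: symD[OF s] intro: rtrancl_trans)
qed

text \<open>A new pair starts only at a point of \<open>K\<close>: a class missing \<open>K\<close>
  stays closed, and each class meeting \<open>K\<close> reaches all others that do.\<close>

lemma comp_of_merge:
  assumes "sym A" "K \<noteq> {}"
  shows "comp_of (A \<union> K \<times> K) x =
    (if comp_of A x \<in> comp_of A ` K then \<Union>(comp_of A ` K) else comp_of A x)"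
proof (cases "comp_of A x \<in> comp_of A ` K")
  case True
  then obtain k where k: "k \<in> K" "(x, k) \<in> A\<^sup>*"
    using comp_of_eq_iff[OF assms(1)] by auto
  have mono: "A\<^sup>* \<subseteq> (A \<union> K \<times> K)\<^sup>*" by (rule rtrancl_mono) auto
  have "y \<in> \<Union>(comp_of A ` K)" if "(x, y) \<in> (A \<union> K \<times> K)\<^sup>*" for y
    using that
  proof induction
    case base
    have "(k, x) \<in> A\<^sup>*" using k sym_rtrancl[OF assms(1)] by (auto dest: symD)
    then show ?case using k by (auto simp: comp_of_def)
  next
    case (step y z)
    then show ?case by (auto simp: comp_of_def intro: rtrancl.rtrancl_into_rtrancl)
  qed
  moreover have "(x, y) \<in> (A \<union> K \<times> K)\<^sup>*" if "y \<in> \<Union>(comp_of A ` K)" for y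
  proof -
    from that obtain l where l: "l \<in> K" "(l, y) \<in> A\<^sup>*" by (auto simp: comp_of_def)
    have "(x, k) \<in> (A \<union> K \<times> K)\<^sup>*" "(l, y) \<in> (A \<union> K \<times> K)\<^sup>*" using k l mono by auto
    moreover have "(k, l) \<in> (A \<union> K \<times> K)\<^sup>*" using k l by auto
    ultimately show ?thesis by (meson rtrancl_trans)
  qed
  ultimately show ?thesis using True by (auto simp: comp_of_def)
next
  case False
  have "(x, y) \<in> A\<^sup>*" if "(x, y) \<in> (A \<union> K \<times> K)\<^sup>*" for y
    using that
  proof induction
    case (step y z)
    have "y \<notin> K" using False step.IH comp_of_eq_iff[OF assms(1)] by (metis image_eqI)
    then show ?case using step by (auto intro: rtrancl.rtrancl_into_rtrancl)
  qed auto
  moreover have "A\<^sup>* \<subseteq> (A \<union> K \<times> K)\<^sup>*" by (rule rtrancl_mono) auto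
  ultimately show ?thesis using False by (auto simp: comp_of_def)
qed

definition ncomps :: "'a set \<Rightarrow> ('a \<times> 'a) set \<Rightarrow> nat" where
  "ncomps R A = card (comp_of A ` R)"

text \<open>The classes that meet \<open>K\<close> are replaced by the single class that is their
  union. This turns the coefficients of the partition inequality into drops in the number of
  classes, which telescope.\<close>

lemma ncomps_merge:
  assumes "sym A" "finite R" "K \<subseteq> R" "K \<noteq> {}"
  shows "real (ncomps R A) - real (ncomps R (A \<union> K \<times> K)) = real (card (comp_of A ` K)) - 1"
proof -
  have img: "comp_of (A \<union> K \<times> K) ` R = insert (\<Union>(comp_of A ` K)) (comp_of A ` R - comp_of A ` K)"
    (is "?L = ?I")
  proof
    show "?L \<subseteq> ?I" using comp_of_merge[OF assms(1,4)] by auto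
    show "?I \<subseteq> ?L"
    proof
      fix C assume "C \<in> ?I"
      then consider "C = \<Union>(comp_of A ` K)" | y where "y \<in> R" "C = comp_of A y" "C \<notin> comp_of A ` K"
        by auto
      then show "C \<in> ?L"
      proof cases
        case 1
        obtain k where "k \<in> K" using assms(4) by auto
        then have "C = comp_of (A \<union> K \<times> K) k" using 1 comp_of_merge[OF assms(1,4), of k] by simp
        then show ?thesis using \<open>k \<in> K\<close> assms(3) by blast
      next
        case 2
        then show ?thesis using comp_of_merge[OF assms(1,4), of y] by (auto simp: image_iff)
      qed
    qed
  qed
  have "\<Union>(comp_of A ` K) \<notin> comp_of A ` R - comp_of A ` K"
  proof
    assume "\<Union>(comp_of A ` K) \<in> comp_of A ` R - comp_of A ` K"
    then obtain y where y: "\<Union>(comp_of A ` K) = comp_of A y" "comp_of A y \<notin> comp_of A ` K" by auto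
    obtain k where k: "k \<in> K" using assms(4) by auto
    then have "k \<in> \<Union>(comp_of A ` K)" by (auto simp: comp_of_def)
    then have "(y, k) \<in> A\<^sup>*" using y by (auto simp: comp_of_def)
    then show False using y k comp_of_eq_iff[OF assms(1)] by blast
  qed
  then have "ncomps R (A \<union> K \<times> K) = Suc (card (comp_of A ` R - comp_of A ` K))"
    unfolding ncomps_def img using assms(2) by simp
  also have "card (comp_of A ` R - comp_of A ` K) = ncomps R A - card (comp_of A ` K)"
    unfolding ncomps_def using assms(2,3) by (intro card_Diff_subset) (auto intro: finite_subset)
  finally have "ncomps R (A \<union> K \<times> K) = Suc (ncomps R A - card (comp_of A ` K))" .
  moreover have "card (comp_of A ` K) \<le> ncomps R A"
    unfolding ncomps_def using assms(2,3) by (intro card_mono) auto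
  ultimately show ?thesis by simp
qed

lemma ncomps_connected:
  assumes "R \<noteq> {}" "R \<times> R \<subseteq> A\<^sup>*" "sym A"
  shows "ncomps R A = 1"
proof -
  obtain r where r: "r \<in> R" using assms by auto
  then have "comp_of A y = comp_of A r" if "y \<in> R" for y
    using assms(2) comp_of_eq_iff[OF assms(3)] that by blast
  then have "comp_of A ` R = {comp_of A r}" using r by blast
  then show ?thesis by (simp add: ncomps_def)
qed

section \<open>Partition inequalities\<close>

lemma finite_comps: "finite R \<Longrightarrow> finite (comps V E R)"
  by (rule finite_subset[of _ "Pow R"]) (auto simp: comps_def)

text \<open>Subtract the constraints of the fibres of f from the spanning equation.\<close>

lemma partition_inequality:
  fixes f :: "'a \<Rightarrow> 'b"
  assumes "finite R" "lp_feasible V E R x"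
  shows "real (card (f ` R)) - 1 \<le> (\<Sum>K\<in>comps V E R. x K * (real (card (f ` K)) - 1))"
proof -
  let ?C = "comps V E R"
  have fC: "finite ?C" by (rule finite_comps[OF assms(1)])
  define S where "S z = {y \<in> R. f y = z}" for z
  have KS: "K \<inter> S z \<noteq> {} \<longleftrightarrow> z \<in> f ` K" if "K \<in> ?C" for K z
    using that by (auto simp: S_def comps_def)
  have fib: "(\<Sum>z\<in>f ` K. real (card (K \<inter> S z))) = real (card K)" if "K \<subseteq> R" for K
  proof -
    have "finite K" using that assms(1) finite_subset by auto
    then have "real (card K) = (\<Sum>z\<in>f ` K. (\<Sum>y | y \<in> K \<and> f y = z. 1))"
      using sum.image_gen[of K "\<lambda>_. 1 :: real" f] by simp
    moreover have "{y. y \<in> K \<and> f y = z} = K \<inter> S z" for z using that by (auto simp: S_def)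
    ultimately show ?thesis by simp
  qed
  \<comment> \<open>Double counting: the sizes of the traces of \<open>K\<close> on the fibres it
    meets, each reduced by one, add up to the size of \<open>K\<close> minus the number of these
    fibres. Read fibre by fibre, the sum becomes one constraint per fibre.\<close>
  have "(\<Sum>K\<in>?C. x K * (real (card K) - real (card (f ` K))))
      = (\<Sum>K\<in>?C. \<Sum>z\<in>f ` R. if K \<inter> S z \<noteq> {} then x K * (real (card (K \<inter> S z)) - 1) else 0)"
  proof (rule sum.cong[OF refl])
    fix K assume K: "K \<in> ?C"
    then have KR: "K \<subseteq> R" by (auto simp: comps_def)
    have "(\<Sum>z\<in>f ` R. if K \<inter> S z \<noteq> {} then x K * (real (card (K \<inter> S z)) - 1) else 0)
      = (\<Sum>z\<in>f ` R. if z \<in> f ` K then x K * (real (card (K \<inter> S z)) - 1) else 0)"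
      using KS[OF K] by simp
    also have "\<dots> = (\<Sum>z\<in>f ` R \<inter> f ` K. x K * (real (card (K \<inter> S z)) - 1))"
      using assms(1) by (simp add: sum.inter_restrict)
    also have "f ` R \<inter> f ` K = f ` K" using KR by auto
    also have "(\<Sum>z\<in>f ` K. x K * (real (card (K \<inter> S z)) - 1))
      = x K * (real (card K) - real (card (f ` K)))"
      using fib[OF KR] by (simp add: sum_distrib_left[symmetric] sum_subtractf)
    finally show "x K * (real (card K) - real (card (f ` K))) =
      (\<Sum>z\<in>f ` R. if K \<inter> S z \<noteq> {} then x K * (real (card (K \<inter> S z)) - 1) else 0)" by simp
  qed
  also have "\<dots> = (\<Sum>z\<in>f ` R. \<Sum>K\<in>?C. if K \<inter> S z \<noteq> {} then x K * (real (card (K \<inter> S z)) - 1) else 0)"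
    by (rule sum.swap)
  also have "\<dots> = (\<Sum>z\<in>f ` R. \<Sum>K\<in>{K \<in> ?C. K \<inter> S z \<noteq> {}}. x K * (real (card (K \<inter> S z)) - 1))"
    using fC by (simp add: sum.inter_filter)
  also have "\<dots> \<le> (\<Sum>z\<in>f ` R. real (card (S z)) - 1)"
  proof (rule sum_mono)
    fix z assume "z \<in> f ` R"
    then have "S z \<subseteq> R" "S z \<noteq> {}" by (auto simp: S_def)
    then show "(\<Sum>K\<in>{K \<in> ?C. K \<inter> S z \<noteq> {}}. x K * (real (card (K \<inter> S z)) - 1)) \<le> real (card (S z)) - 1"
      using assms(2) unfolding lp_feasible_def by blast
  qed
  also have "\<dots> = real (card R) - real (card (f ` R))"
  proof -
    have "R \<inter> S z = S z" for z by (auto simp: S_def)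
    then show ?thesis using fib[of R] by (simp add: sum_subtractf)
  qed
  finally have "(\<Sum>K\<in>?C. x K * (real (card K) - real (card (f ` K)))) \<le> real (card R) - real (card (f ` R))" .
  moreover have "(\<Sum>K\<in>?C. x K * (real (card K) - 1)) = real (card R) - 1"
    using assms(2) by (simp add: lp_feasible_def)
  moreover have "(\<Sum>K\<in>?C. x K * (real (card K) - 1)) - (\<Sum>K\<in>?C. x K * (real (card K) - real (card (f ` K))))
    = (\<Sum>K\<in>?C. x K * (real (card (f ` K)) - 1))"
    by (simp add: sum_subtractf[symmetric] algebra_simps)
  ultimately show ?thesis by linarith
qed

section \<open>Kruskal's algorithm and the cost of its result\<close>

text \<open>A link counts as the complete relation on its ends, so that adding a link and
  contracting a component have the same form, a union with a square.\<close>

definition cliques :: "('e \<Rightarrow> 'a set) \<Rightarrow> 'e set \<Rightarrow> ('a \<times> 'a) set" where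
  "cliques en T = (\<Union>e\<in>T. en e \<times> en e)"

lemma sym_cliques: "sym (cliques en T)"
  by (auto simp: cliques_def sym_def)

lemma sym_Un_square: "sym A \<Longrightarrow> sym (A \<union> K \<times> K)"
  by (auto simp: sym_def)

lemma cliques_insert: "cliques en (insert e T) = en e \<times> en e \<union> cliques en T"
  by (auto simp: cliques_def)

lemma cliques_Un: "cliques en (S \<union> T) = cliques en S \<union> cliques en T"
  by (auto simp: cliques_def)

lemma cliques_mono: "S \<subseteq> T \<Longrightarrow> cliques en S \<subseteq> cliques en T"
  by (auto simp: cliques_def)

text \<open>Kruskal's algorithm along the list, started from the classes of \<open>A\<close>: for a
  link \<open>{u, v}\<close> the drop is 1 if it joins two classes and 0 if not. Expressing the
  choice by a drop makes summation by parts possible.\<close>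

fun greedy_cost :: "('e \<Rightarrow> 'a set) \<Rightarrow> ('e \<Rightarrow> real) \<Rightarrow> 'a set \<Rightarrow> ('a \<times> 'a) set \<Rightarrow> 'e list \<Rightarrow> real" where
  "greedy_cost en w R A [] = 0"
| "greedy_cost en w R A (e # es) =
     w e * (real (ncomps R A) - real (ncomps R (A \<union> en e \<times> en e))) + greedy_cost en w R (A \<union> en e \<times> en e) es"

text \<open>\<open>B\<close> collects the links whose drop is 1. A rejected link lies in the closure
  of the relation built so far, so leaving it out changes no class.\<close>

lemma greedy_subset:
  assumes "finite R" "sym A" "distinct es" "\<And>e. e \<in> set es \<Longrightarrow> \<exists>u\<in>R. \<exists>v\<in>R. en e = {u, v}"
  shows "\<exists>B\<subseteq>set es. sum w B = greedy_cost en w R A es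
    \<and> (A \<union> cliques en B)\<^sup>* = (A \<union> cliques en (set es))\<^sup>*"
  using assms(2-)
proof (induction es arbitrary: A)
  case Nil
  then show ?case by simp
next
  case (Cons e es)
  let ?A = "A \<union> en e \<times> en e"
  obtain u v where uv: "u \<in> R" "v \<in> R" "en e = {u, v}" using Cons.prems(3)[of e] by auto
  have "sym ?A" using Cons.prems(1) by (rule sym_Un_square)
  then obtain B where B: "B \<subseteq> set es" "sum w B = greedy_cost en w R ?A es"
    "(?A \<union> cliques en B)\<^sup>* = (?A \<union> cliques en (set es))\<^sup>*"
    using Cons.IH[of ?A] Cons.prems by auto
  have "finite B" "e \<notin> B" using B(1) Cons.prems(2) by (auto intro: finite_subset)
  have nc: "real (ncomps R A) - real (ncomps R ?A) = real (card (comp_of A ` {u, v})) - 1"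
    using ncomps_merge[OF Cons.prems(1) assms(1), of "{u, v}"] uv by auto
  show ?case
  proof (cases "(u, v) \<in> A\<^sup>*")
    case True
    then have "comp_of A u = comp_of A v" using comp_of_eq_iff[OF Cons.prems(1)] by auto
    then have "real (ncomps R A) - real (ncomps R ?A) = 0" using nc by simp
    then have "sum w B = greedy_cost en w R A (e # es)" using B by simp
    moreover have "(A \<union> cliques en B)\<^sup>* = (?A \<union> cliques en B)\<^sup>*"
    proof (rule rtrancl_subset[symmetric])
      have "(v, u) \<in> A\<^sup>*" using True sym_rtrancl[OF Cons.prems(1)] by (auto dest: symD)
      then have "en e \<times> en e \<subseteq> A\<^sup>*" using True uv by auto
      also have "A\<^sup>* \<subseteq> (A \<union> cliques en B)\<^sup>*" by (rule rtrancl_mono) auto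
      finally show "?A \<union> cliques en B \<subseteq> (A \<union> cliques en B)\<^sup>*" by auto
    qed auto
    ultimately show ?thesis using B by (intro exI[of _ B]) (auto simp: cliques_insert Un_assoc)
  next
    case False
    then have "comp_of A u \<noteq> comp_of A v" using comp_of_eq_iff[OF Cons.prems(1)] by auto
    then have "real (ncomps R A) - real (ncomps R ?A) = 1" using nc by simp
    then have "sum w (insert e B) = greedy_cost en w R A (e # es)"
      using B \<open>finite B\<close> \<open>e \<notin> B\<close> by simp
    then show ?thesis using B by (intro exI[of _ "insert e B"]) (auto simp: cliques_insert Un_assoc)
  qed
qed

text \<open>Abel summation along the greedy order. The hypothesis \<open>part\<close> says that the slack
  of the partition inequality is nonnegative; the slack vanishes once everything is connected.\<close>

lemma greedy_bridge:
  fixes x :: "'a set \<Rightarrow> real"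
  assumes "finite R" "R \<noteq> {}" "sym A" "sorted (map w es)" "\<And>e. e \<in> set es \<Longrightarrow> b \<le> w e"
    and "R \<times> R \<subseteq> (A \<union> cliques en (set es))\<^sup>*"
    and sub: "\<And>K. K \<in> C \<Longrightarrow> K \<subseteq> R \<and> K \<noteq> {}"
    and part: "\<And>A. sym A \<Longrightarrow> real (ncomps R A) - 1
      \<le> (\<Sum>K\<in>C. x K * (real (ncomps R A) - real (ncomps R (A \<union> K \<times> K))))"
  shows "b * ((\<Sum>K\<in>C. x K * (real (ncomps R A) - real (ncomps R (A \<union> K \<times> K)))) - (real (ncomps R A) - 1))
    \<le> (\<Sum>K\<in>C. x K * (greedy_cost en w R A es - greedy_cost en w R (A \<union> K \<times> K) es)) - greedy_cost en w R A es"
  using assms(3-6)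
proof (induction es arbitrary: A b)
  case Nil
  \<comment> \<open>With no links left, \<open>A\<close> alone connects \<open>R\<close>; every
    count is 1 and both sides are 0.\<close>
  then have RA: "R \<times> R \<subseteq> A\<^sup>*" by (simp add: cliques_def)
  have n1: "ncomps R A = 1" by (rule ncomps_connected[OF assms(2) RA Nil.prems(1)])
  have n2: "ncomps R (A \<union> K \<times> K) = 1" if "K \<in> C" for K
  proof (rule ncomps_connected[OF assms(2)])
    show "R \<times> R \<subseteq> (A \<union> K \<times> K)\<^sup>*" using RA rtrancl_mono[of A "A \<union> K \<times> K"] by auto
    show "sym (A \<union> K \<times> K)" using Nil.prems(1) by (rule sym_Un_square)
  qed
  show ?case using n1 n2 by simp
next
  case (Cons e es)
  let ?A = "A \<union> en e \<times> en e"
  let ?g = "\<lambda>A. \<Sum>K\<in>C. x K * (real (ncomps R A) - real (ncomps R (A \<union> K \<times> K)))"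
  let ?G = "\<lambda>A es. \<Sum>K\<in>C. x K * (greedy_cost en w R A es - greedy_cost en w R (A \<union> K \<times> K) es)"
  have sA: "sym ?A" using Cons.prems(1) by (rule sym_Un_square)
  have comm: "A \<union> K \<times> K \<union> en e \<times> en e = ?A \<union> K \<times> K" for K by auto
  have tail: "w e * (?g ?A - (real (ncomps R ?A) - 1)) \<le> ?G ?A es - greedy_cost en w R ?A es"
  proof (rule Cons.IH[OF sA])
    show "sorted (map w es)" using Cons.prems(2) by simp
    show "w e \<le> w e'" if "e' \<in> set es" for e' using Cons.prems(2) that by simp
    show "R \<times> R \<subseteq> (?A \<union> cliques en (set es))\<^sup>*"
      using Cons.prems(4) by (simp add: cliques_insert Un_assoc)
  qed
  \<comment> \<open>The drop of \<open>e\<close> at \<open>A\<close> minus its drop after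
    contracting \<open>K\<close> equals the drop of \<open>K\<close> at \<open>A\<close> minus its
    drop after adding \<open>e\<close>.\<close>
  have "?G A (e # es) = w e * ?g A - w e * ?g ?A + ?G ?A es"
    by (simp add: comm sum_distrib_left sum.distrib[symmetric] sum_subtractf[symmetric] algebra_simps)
  \<comment> \<open>The slack is nonnegative by \<open>part\<close>, so its factor may be raised
    from \<open>b\<close> to \<open>w e\<close>.\<close>
  moreover have "b * (?g A - (real (ncomps R A) - 1)) \<le> w e * (?g A - (real (ncomps R A) - 1))"
    using Cons.prems(3)[of e] part[OF Cons.prems(1)] by (intro mult_right_mono) auto
  ultimately show ?case using tail by (simp add: algebra_simps)
qed

text \<open>Kruskal's algorithm runs over \<open>T\<close> in order of weight, from the empty
  relation for \<open>B0\<close> and from \<open>K \<times> K\<close> for \<open>B K\<close>. The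
  cost difference is the saving from contracting \<open>K\<close>.\<close>

lemma bridge:
  assumes "finite R" "R \<noteq> {}" "lp_feasible V E R x" "finite T"
    and "\<And>e. e \<in> T \<Longrightarrow> \<exists>u\<in>R. \<exists>v\<in>R. en e = {u, v}"
    and "\<And>e. e \<in> T \<Longrightarrow> 0 \<le> w e"
    and "R \<times> R \<subseteq> (cliques en T)\<^sup>*"
  obtains B0 B where "B0 \<subseteq> T" "R \<times> R \<subseteq> (cliques en B0)\<^sup>*"
    "\<forall>K\<in>comps V E R. B K \<subseteq> T \<and> R \<times> R \<subseteq> (K \<times> K \<union> cliques en (B K))\<^sup>*"
    "sum w B0 \<le> (\<Sum>K\<in>comps V E R. x K * (sum w B0 - sum w (B K)))"
proof -
  obtain l where l: "set l = T" "distinct l" using finite_distinct_list[OF assms(4)] by auto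
  define es where "es = sort_key w l"
  have es: "set es = T" "distinct es" "sorted (map w es)" using l by (auto simp: es_def)
  have gs: "\<exists>B\<subseteq>T. sum w B = greedy_cost en w R A es \<and> (A \<union> cliques en B)\<^sup>* = (A \<union> cliques en T)\<^sup>*"
    if "sym A" for A
    using greedy_subset[OF assms(1) that es(2), of en w] assms(5) es(1) by auto
  obtain B0 where B0: "B0 \<subseteq> T" "sum w B0 = greedy_cost en w R {} es" "(cliques en B0)\<^sup>* = (cliques en T)\<^sup>*"
    using gs[of "{}"] by (auto simp: sym_def)
  have "\<exists>B. \<forall>K. B K \<subseteq> T \<and> sum w (B K) = greedy_cost en w R (K \<times> K) es
      \<and> (K \<times> K \<union> cliques en (B K))\<^sup>* = (K \<times> K \<union> cliques en T)\<^sup>*"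
  proof (rule choice, rule allI)
    fix K :: "'a set"
    show "\<exists>B\<subseteq>T. sum w B = greedy_cost en w R (K \<times> K) es \<and> (K \<times> K \<union> cliques en B)\<^sup>* = (K \<times> K \<union> cliques en T)\<^sup>*"
      by (rule gs) (auto simp: sym_def)
  qed
  then obtain B where B: "\<And>K. B K \<subseteq> T" "\<And>K. sum w (B K) = greedy_cost en w R (K \<times> K) es"
    "\<And>K. (K \<times> K \<union> cliques en (B K))\<^sup>* = (K \<times> K \<union> cliques en T)\<^sup>*" by auto
  have sub: "K \<subseteq> R \<and> K \<noteq> {}" if "K \<in> comps V E R" for K using that by (auto simp: comps_def)
  \<comment> \<open>The case \<open>A = {}\<close> of \<open>greedy_bridge\<close>, with 0 as lower
    bound of the weights, which removes the slack.\<close>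
  have "0 * ((\<Sum>K\<in>comps V E R. x K * (real (ncomps R {}) - real (ncomps R ({} \<union> K \<times> K)))) - (real (ncomps R {}) - 1))
    \<le> (\<Sum>K\<in>comps V E R. x K * (greedy_cost en w R {} es - greedy_cost en w R ({} \<union> K \<times> K) es)) - greedy_cost en w R {} es"
  proof (rule greedy_bridge[OF assms(1,2) _ es(3) _ _ sub])
    fix A :: "('a \<times> 'a) set" assume A: "sym A"
    have "(\<Sum>K\<in>comps V E R. x K * (real (ncomps R A) - real (ncomps R (A \<union> K \<times> K))))
      = (\<Sum>K\<in>comps V E R. x K * (real (card (comp_of A ` K)) - 1))"
      using ncomps_merge[OF A assms(1)] sub by (intro sum.cong) auto
    then show "real (ncomps R A) - 1
      \<le> (\<Sum>K\<in>comps V E R. x K * (real (ncomps R A) - real (ncomps R (A \<union> K \<times> K))))"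
      using partition_inequality[OF assms(1,3), of "comp_of A"] by (simp add: ncomps_def)
  qed (use assms es in \<open>auto simp: sym_def\<close>)
  then have "sum w B0 \<le> (\<Sum>K\<in>comps V E R. x K * (sum w B0 - sum w (B K)))"
    using B0 B by simp
  moreover have "R \<times> R \<subseteq> (K \<times> K \<union> cliques en (B K))\<^sup>*" for K
    using assms(7) rtrancl_mono[of "cliques en T" "K \<times> K \<union> cliques en T"] B(3)[of K] by auto
  ultimately show ?thesis using that[of B0 B] B0 B assms(7) by auto
qed

section \<open>Loss and doubling of trees\<close>

definition adj :: "'a set set \<Rightarrow> ('a \<times> 'a) set" where
  "adj D = {(a, b). {a, b} \<in> D}"

lemma adj_mono: "D \<subseteq> F \<Longrightarrow> adj D \<subseteq> adj F"
  by (auto simp: adj_def)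

lemma adj_rtrancl_mono: "(u, v) \<in> (adj D)\<^sup>* \<Longrightarrow> D \<subseteq> F \<Longrightarrow> (u, v) \<in> (adj F)\<^sup>*"
  using rtrancl_mono[OF adj_mono] by blast

lemma adj_rtrancl_sym: "(u, v) \<in> (adj D)\<^sup>* \<Longrightarrow> (v, u) \<in> (adj D)\<^sup>*"
  by (rule symD[OF sym_rtrancl]) (auto simp: adj_def sym_def insert_commute)

text \<open>The rule \<open>join\<close> hangs a tree rooted at \<open>u\<close> below the root
  \<open>v\<close>, so induction splits off one child at a time, however many children a vertex
  has.\<close>

inductive rtree :: "'a \<Rightarrow> 'a set \<Rightarrow> 'a set set \<Rightarrow> bool" where
  single: "rtree v {v} {}"
| join: "rtree v W1 F1 \<Longrightarrow> rtree u W2 F2 \<Longrightarrow> W1 \<inter> W2 = {} \<Longrightarrow>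
    rtree v (W1 \<union> W2) (insert {v, u} (F1 \<union> F2))"

lemma rtree_basic:
  assumes "rtree v W F"
  shows "finite W" "finite F" "v \<in> W" "e \<in> F \<Longrightarrow> e \<subseteq> W \<and> e \<noteq> {}"
proof -
  have "finite W \<and> finite F \<and> v \<in> W \<and> (\<forall>e\<in>F. e \<subseteq> W \<and> e \<noteq> {})"
    using assms by induction auto
  then show "finite W" "finite F" "v \<in> W" "e \<in> F \<Longrightarrow> e \<subseteq> W \<and> e \<noteq> {}" by auto
qed

text \<open>The new edge crosses between the two vertex sets, and nonempty edges within disjoint
  sets differ; hence costs and cardinalities add up under \<open>join\<close>.\<close>

lemma rtree_join_edges:
  assumes "rtree v W1 F1" "rtree u W2 F2" "W1 \<inter> W2 = {}"
  shows "{v, u} \<notin> F1" "{v, u} \<notin> F2" "F1 \<inter> F2 = {}"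
proof -
  have "u \<notin> W1" "v \<notin> W2" using rtree_basic(3)[OF assms(1)] rtree_basic(3)[OF assms(2)] assms(3) by auto
  then show "{v, u} \<notin> F1" "{v, u} \<notin> F2"
    using rtree_basic(4)[OF assms(1)] rtree_basic(4)[OF assms(2)] by auto
  show "F1 \<inter> F2 = {}"
  proof (rule ccontr)
    assume "F1 \<inter> F2 \<noteq> {}"
    then obtain e where "e \<in> F1" "e \<in> F2" by auto
    then have "e \<subseteq> W1 \<inter> W2" "e \<noteq> {}"
      using rtree_basic(4)[OF assms(1)] rtree_basic(4)[OF assms(2)] by auto
    then show False using assms(3) by auto
  qed
qed

lemma rtree_connected: "rtree v W F \<Longrightarrow> w \<in> W \<Longrightarrow> (v, w) \<in> (adj F)\<^sup>*"
proof (induction arbitrary: w rule: rtree.induct)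
  case (single v)
  then show ?case by simp
next
  case (join v W1 F1 u W2 F2)
  let ?F = "insert {v, u} (F1 \<union> F2)"
  show ?case
  proof (cases "w \<in> W1")
    case True
    show ?thesis using join.IH(1)[OF True] by (rule adj_rtrancl_mono) auto
  next
    case False
    then have "(u, w) \<in> (adj F2)\<^sup>*" using join.IH(2) join.prems by auto
    then have "(u, w) \<in> (adj ?F)\<^sup>*" by (rule adj_rtrancl_mono) auto
    moreover have "(v, u) \<in> adj ?F" by (auto simp: adj_def)
    ultimately show ?thesis by (rule converse_rtrancl_into_rtrancl[rotated])
  qed
qed

lemma rtree_card: "rtree v W F \<Longrightarrow> card F + 1 = card W"
proof (induction rule: rtree.induct)
  case (single v)
  then show ?case by simp
next
  case (join v W1 F1 u W2 F2)
  note d = rtree_join_edges[OF join.hyps(1,2,3)]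
  have "card (insert {v, u} (F1 \<union> F2)) = Suc (card F1 + card F2)"
    using d rtree_basic(2)[OF join.hyps(1)] rtree_basic(2)[OF join.hyps(2)] by (simp add: card_Un_disjoint)
  moreover have "card (W1 \<union> W2) = card W1 + card W2"
    using join.hyps rtree_basic(1) by (intro card_Un_disjoint) auto
  ultimately show ?case using join.IH by simp
qed

text \<open>\<open>join\<close> acts at the root only, so a new leaf is passed down to the subtree
  that contains its neighbour \<open>u\<close>.\<close>

lemma rtree_grow:
  "rtree v W F \<Longrightarrow> u \<in> W \<Longrightarrow> z \<notin> W \<Longrightarrow> rtree v (insert z W) (insert {u, z} F)"
proof (induction arbitrary: u rule: rtree.induct)
  case (single v)
  have "rtree v ({v} \<union> {z}) (insert {v, z} ({} \<union> {}))"
    using single by (intro rtree.join rtree.single) auto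
  then show ?case using single by (simp add: insert_commute)
next
  case (join v W1 F1 y W2 F2)
  show ?case
  proof (cases "u \<in> W1")
    case True
    have "rtree v (insert z W1 \<union> W2) (insert {v, y} (insert {u, z} F1 \<union> F2))"
      using join True by (intro rtree.join) auto
    then show ?thesis by (simp add: insert_commute)
  next
    case False
    have "rtree v (W1 \<union> insert z W2) (insert {v, y} (F1 \<union> insert {u, z} F2))"
      using join False by (intro rtree.join) auto
    then show ?thesis by (simp add: insert_commute)
  qed
qed

lemma rtrancl_crossing:
  assumes "(a, b) \<in> r\<^sup>*" "a \<in> S" "b \<notin> S"
  shows "\<exists>p q. (p, q) \<in> r \<and> p \<in> S \<and> q \<notin> S"
  using assms by induction auto

text \<open>A maximal vertex set carrying such a tree is all of \<open>W\<close>: otherwise a path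
  from \<open>v\<close> leaves it along an edge of \<open>F\<close>, which can be added.\<close>

lemma spanning_rtree:
  assumes "finite W" "\<And>w. w \<in> W \<Longrightarrow> (v, w) \<in> (adj F)\<^sup>*" "\<And>e. e \<in> F \<Longrightarrow> e \<subseteq> W" "v \<in> W"
  obtains F' where "F' \<subseteq> F" "rtree v W F'"
proof -
  define C where "C = {S. S \<subseteq> W \<and> (\<exists>F'\<subseteq>F. rtree v S F')}"
  have "finite C" using assms(1) by (simp add: C_def)
  moreover have "{v} \<in> C" using assms(4) rtree.single[of v] unfolding C_def by blast
  ultimately obtain S where S: "S \<in> C" and mx: "\<And>S'. S' \<in> C \<Longrightarrow> S \<subseteq> S' \<Longrightarrow> S = S'"
    using finite_has_maximal[of C] by blast
  then obtain F' where F': "F' \<subseteq> F" "rtree v S F'" "S \<subseteq> W" by (auto simp: C_def)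
  have "S = W"
  proof (rule ccontr)
    assume "S \<noteq> W"
    then obtain w where "w \<in> W" "w \<notin> S" using F' by auto
    then obtain p q where pq: "(p, q) \<in> adj F" "p \<in> S" "q \<notin> S"
      using rtrancl_crossing assms(2) rtree_basic(3)[OF F'(2)] by metis
    then have "rtree v (insert q S) (insert {p, q} F')" using rtree_grow F' by metis
    moreover have "{p, q} \<in> F" using pq by (simp add: adj_def)
    moreover have "q \<in> W" using \<open>{p, q} \<in> F\<close> assms(3) by auto
    ultimately have "insert q S \<in> C" using F' unfolding C_def by blast
    then show False using mx[of "insert q S"] pq by auto
  qed
  then show ?thesis using that F' by auto
qed

text \<open>A link is an edge between two terminals together with the set of graph edges that pays for it;
  it is usable once the edges in the third argument have been bought.\<close>

definition links :: "'a set \<Rightarrow> 'a set set \<Rightarrow> 'a set set \<Rightarrow> ('a set \<times> 'a set set) set" where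
  "links X E L = {(N, D). D \<subseteq> E \<and> (\<exists>u\<in>X. \<exists>v\<in>X. N = {u, v} \<and> (u, v) \<in> (adj (D \<union> L))\<^sup>*)}"

lemma links_mono: "X \<subseteq> X' \<Longrightarrow> E \<subseteq> E' \<Longrightarrow> L \<subseteq> L' \<Longrightarrow> links X E L \<subseteq> links X' E' L'"
proof
  fix l assume X: "X \<subseteq> X'" and E: "E \<subseteq> E'" and L: "L \<subseteq> L'" and "l \<in> links X E L"
  then obtain u v D where l: "l = ({u, v}, D)" "D \<subseteq> E" "u \<in> X" "v \<in> X" "(u, v) \<in> (adj (D \<union> L))\<^sup>*"
    by (auto simp: links_def)
  have "(u, v) \<in> (adj (D \<union> L'))\<^sup>*"
    by (rule adj_rtrancl_mono[OF l(5)]) (use L in auto)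
  then show "l \<in> links X' E' L'" using l X E unfolding links_def by blast
qed

definition link_cost :: "('a set \<Rightarrow> real) \<Rightarrow> ('a set \<times> 'a set set) \<Rightarrow> real" where
  "link_cost c l = sum c (snd l)"

definition spans :: "('a set \<times> 'a set set) set \<Rightarrow> 'a set \<Rightarrow> bool" where
  "spans T X \<longleftrightarrow> X \<times> X \<subseteq> (cliques fst T)\<^sup>*"

lemma spans_mono: "spans S X \<Longrightarrow> S \<subseteq> T \<Longrightarrow> spans T X"
  unfolding spans_def using rtrancl_mono[OF cliques_mono] by blast

lemma spans_join:
  assumes "spans T1 X" "spans T2 Y" "a \<in> X" "b \<in> Y"
  shows "spans (insert ({a, b}, D) (T1 \<union> T2)) (X \<union> Y)"
proof -
  let ?T = "insert ({a, b}, D) (T1 \<union> T2)"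
  let ?R = "(cliques fst ?T)\<^sup>*"
  have X: "X \<times> X \<subseteq> ?R" using spans_mono[OF assms(1), of ?T] by (auto simp: spans_def)
  have Y: "Y \<times> Y \<subseteq> ?R" using spans_mono[OF assms(2), of ?T] by (auto simp: spans_def)
  have ab: "(a, b) \<in> ?R" "(b, a) \<in> ?R" by (auto simp: cliques_def)
  have "(x, y) \<in> ?R" "(y, x) \<in> ?R" if "x \<in> X" "y \<in> Y" for x y
  proof -
    have "(x, a) \<in> ?R" "(b, y) \<in> ?R" "(a, x) \<in> ?R" "(y, b) \<in> ?R" using X Y that assms by auto
    then show "(x, y) \<in> ?R" "(y, x) \<in> ?R" using ab by (meson rtrancl_trans)+
  qed
  then show ?thesis using X Y unfolding spans_def by auto
qed

lemma sum_Un_le: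
  fixes c :: "'b \<Rightarrow> real"
  assumes "\<And>e. 0 \<le> c e" "finite A" "finite B"
  shows "sum c (A \<union> B) \<le> sum c A + sum c B"
  using sum.union_inter[OF assms(2,3), of c] sum_nonneg[of "A \<inter> B" c] assms(1) by auto

lemma sum_insert_le:
  fixes c :: "'b \<Rightarrow> real"
  assumes "\<And>e. 0 \<le> c e" "finite A"
  shows "sum c (insert a A) \<le> c a + sum c A"
  using assms by (cases "a \<in> A") (auto simp: insert_absorb)

lemma link_cost_nonneg: "(\<And>e. 0 \<le> c e) \<Longrightarrow> 0 \<le> link_cost c l"
  by (simp add: link_cost_def sum_nonneg)

section \<open>The loss of a tree\<close>

text \<open>The recursion shared by loss and doubling. \<open>Q\<close> speaks of the terminals in
  the tree only: branches without terminals are absorbed by \<open>mono\<close>, the edge to a child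
  is handled by \<open>extend\<close>, and \<open>merge\<close> unites two branches at the same
  root.\<close>

lemma rtree_terminal_induct:
  assumes "rtree v W F" "X \<inter> W \<noteq> {}"
    and single: "\<And>v. Q {v} {} v"
    and extend: "\<And>Y F u v. finite F \<Longrightarrow> Q Y F u \<Longrightarrow> {v, u} \<notin> F \<Longrightarrow> Q Y (insert {v, u} F) v"
    and merge: "\<And>Y1 Y2 F1 F2 v. finite F1 \<Longrightarrow> finite F2 \<Longrightarrow> F1 \<inter> F2 = {} \<Longrightarrow> Q Y1 F1 v \<Longrightarrow> Q Y2 F2 v
      \<Longrightarrow> Q (Y1 \<union> Y2) (F1 \<union> F2) v"
    and mono: "\<And>Y F F' v. finite F' \<Longrightarrow> F \<subseteq> F' \<Longrightarrow> Q Y F v \<Longrightarrow> Q Y F' v"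
  shows "Q (X \<inter> W) F v"
  using assms(1,2)
proof (induction rule: rtree.induct)
  case (single v)
  then have "X \<inter> {v} = {v}" by auto
  then show ?case using assms(3) by simp
next
  case (join v W1 F1 u W2 F2)
  note fin = rtree_basic(2)[OF join.hyps(1)] rtree_basic(2)[OF join.hyps(2)]
  note d = rtree_join_edges[OF join.hyps(1-3)]
  have vu: "{v, u} \<notin> F1 \<union> F2" "F1 \<inter> insert {v, u} F2 = {}" using d by auto
  \<comment> \<open>The edge to the child is given to the lower branch, so that both branches are
    rooted at \<open>v\<close>.\<close>
  have U: "insert {v, u} (F1 \<union> F2) = F1 \<union> insert {v, u} F2" by auto
  have 2: "Q (X \<inter> W2) (insert {v, u} F2) v" if "X \<inter> W2 \<noteq> {}"
    using join.IH(2)[OF that] extend fin d by auto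
  consider "X \<inter> W1 = {}" | "X \<inter> W2 = {}" | "X \<inter> W1 \<noteq> {}" "X \<inter> W2 \<noteq> {}" by auto
  then show ?case
  proof cases
    case 1
    then have "X \<inter> (W1 \<union> W2) = X \<inter> W2" by auto
    then show ?thesis using 2 join.prems fin by (auto intro: mono[of _ "insert {v, u} F2"])
  next
    case 2
    then have "X \<inter> (W1 \<union> W2) = X \<inter> W1" by auto
    then show ?thesis using join.IH(1) join.prems fin by (auto intro: mono[of _ F1])
  next
    case 3
    have "Q ((X \<inter> W1) \<union> (X \<inter> W2)) (F1 \<union> insert {v, u} F2) v"
      using 3 2 join.IH(1) fin vu by (intro merge) auto
    then show ?thesis unfolding U by (simp add: Int_Un_distrib)
  qed
qed

text \<open>The pendant path \<open>P\<close> leads from the root to the terminal \<open>t\<close>. When two branches meet,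
  the cheaper pendant path joins the loss \<open>L\<close> and the other one becomes a link.\<close>

definition lossy :: "('a set \<Rightarrow> real) \<Rightarrow> 'a set \<Rightarrow> 'a set set \<Rightarrow> 'a \<Rightarrow>
    'a set set \<Rightarrow> ('a set \<times> 'a set set) set \<Rightarrow> 'a set set \<Rightarrow> 'a \<Rightarrow> bool" where
  "lossy c X F v L T P t \<longleftrightarrow> L \<subseteq> F \<and> P \<subseteq> F \<and> finite T \<and> T \<subseteq> links X F L \<and> spans T X
     \<and> t \<in> X \<and> (v, t) \<in> (adj (P \<union> L))\<^sup>*
     \<and> sum c L + sum (link_cost c) T + sum c P \<le> sum c F \<and> 2 * sum c L + sum c P \<le> sum c F"

text \<open>Once \<open>P1\<close> is bought, \<open>t1\<close> is reached from \<open>v\<close> at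
  no further cost, so the new pendant path is empty, and \<open>P2\<close> pays for a link from
  \<open>t1\<close> to \<open>t2\<close> through \<open>v\<close>. The bound on the loss survives
  because twice the cost of \<open>P1\<close> is at most the cost of \<open>P1\<close> and
  \<open>P2\<close> together.\<close>

lemma lossy_merge_aux:
  assumes c: "\<And>e. 0 \<le> c e" and "finite F1" "finite F2" "F1 \<inter> F2 = {}"
    and 1: "lossy c X1 F1 v L1 T1 P1 t1" and 2: "lossy c X2 F2 v L2 T2 P2 t2"
    and le: "sum c P1 \<le> sum c P2"
  shows "lossy c (X1 \<union> X2) (F1 \<union> F2) v (L1 \<union> L2 \<union> P1) (insert ({t1, t2}, P2) (T1 \<union> T2)) {} t1"
proof -
  have fin: "finite L1" "finite L2" "finite P1" "finite P2" "finite T1" "finite T2"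
    using 1 2 assms(2,3) by (auto simp: lossy_def intro: finite_subset)
  let ?L = "L1 \<union> L2 \<union> P1" and ?T = "insert ({t1, t2}, P2) (T1 \<union> T2)"
  have v1: "(v, t1) \<in> (adj ?L)\<^sup>*"
    by (rule adj_rtrancl_mono[of _ _ "P1 \<union> L1"]) (use 1 in \<open>auto simp: lossy_def\<close>)
  have "(t1, v) \<in> (adj (P2 \<union> ?L))\<^sup>*"
    by (rule adj_rtrancl_mono[OF adj_rtrancl_sym[OF v1]]) auto
  moreover have "(v, t2) \<in> (adj (P2 \<union> ?L))\<^sup>*"
    by (rule adj_rtrancl_mono[of _ _ "P2 \<union> L2"]) (use 2 in \<open>auto simp: lossy_def\<close>)
  ultimately have "(t1, t2) \<in> (adj (P2 \<union> ?L))\<^sup>*" by (rule rtrancl_trans)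
  then have "({t1, t2}, P2) \<in> links (X1 \<union> X2) (F1 \<union> F2) ?L"
    using 1 2 unfolding links_def lossy_def by auto
  moreover have "T1 \<subseteq> links (X1 \<union> X2) (F1 \<union> F2) ?L"
    using 1 links_mono[of X1 "X1 \<union> X2" F1 "F1 \<union> F2" L1 ?L] by (auto simp: lossy_def)
  moreover have "T2 \<subseteq> links (X1 \<union> X2) (F1 \<union> F2) ?L"
    using 2 links_mono[of X2 "X1 \<union> X2" F2 "F1 \<union> F2" L2 ?L] by (auto simp: lossy_def)
  ultimately have T: "?T \<subseteq> links (X1 \<union> X2) (F1 \<union> F2) ?L" by auto
  have sp: "spans ?T (X1 \<union> X2)" by (rule spans_join) (use 1 2 in \<open>auto simp: lossy_def\<close>)
  have sL: "sum c ?L \<le> sum c L1 + sum c L2 + sum c P1"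
    using sum_Un_le[of c "L1 \<union> L2" P1, OF c] sum_Un_le[of c L1 L2, OF c] fin by simp
  have sT: "sum (link_cost c) ?T \<le> sum c P2 + sum (link_cost c) T1 + sum (link_cost c) T2"
    using sum_insert_le[of "link_cost c" "T1 \<union> T2" "({t1, t2}, P2)", OF link_cost_nonneg[OF c]]
      sum_Un_le[of "link_cost c" T1 T2, OF link_cost_nonneg[OF c]] fin
    by (simp add: link_cost_def[of c "({t1, t2}, P2)"])
  have sF: "sum c (F1 \<union> F2) = sum c F1 + sum c F2" using assms(2-4) by (rule sum.union_disjoint)
  have "?L \<subseteq> F1 \<union> F2" "t1 \<in> X1 \<union> X2" using 1 2 by (auto simp: lossy_def)
  then show ?thesis
    using T sp sL sT sF v1 le 1 2 fin by (simp add: lossy_def)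
qed

text \<open>Both bounds are read off the invariant \<open>lossy\<close> at the root, where the
  remaining pendant path is dropped.\<close>

lemma loss_decomposition:
  assumes c: "\<And>e. 0 \<le> c e" and "rtree v W F" "X \<subseteq> W" "X \<noteq> {}"
  obtains L T where "L \<subseteq> F" "finite T" "T \<subseteq> links X F L" "spans T X"
    "sum c L + sum (link_cost c) T \<le> sum c F" "2 * sum c L \<le> sum c F"
proof -
  let ?Q = "\<lambda>X F v. \<exists>L T P t. lossy c X F v L T P t"
  have "?Q (X \<inter> W) F v"
  proof (rule rtree_terminal_induct[OF assms(2), where Q = ?Q])
    fix v :: 'a
    have "lossy c {v} {} v {} {} {} v" by (auto simp: lossy_def spans_def)
    then show "?Q {v} {} v" by blast
  next
    fix Y and F :: "'a set set" and u v
    assume F: "finite F" "?Q Y F u" "{v, u} \<notin> F"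
    then obtain L T P t where s: "lossy c Y F u L T P t" by auto
    have "finite P" "{v, u} \<notin> P" using s F by (auto simp: lossy_def intro: finite_subset)
    moreover have "T \<subseteq> links Y (insert {v, u} F) L"
      using s links_mono[of Y Y F "insert {v, u} F" L L] by (auto simp: lossy_def)
    moreover have "(v, t) \<in> (adj (insert {v, u} (P \<union> L)))\<^sup>*"
    proof (rule converse_rtrancl_into_rtrancl)
      show "(v, u) \<in> adj (insert {v, u} (P \<union> L))" by (simp add: adj_def)
      show "(u, t) \<in> (adj (insert {v, u} (P \<union> L)))\<^sup>*"
        by (rule adj_rtrancl_mono[of _ _ "P \<union> L"]) (use s in \<open>auto simp: lossy_def\<close>)
    qed
    ultimately have "lossy c Y (insert {v, u} F) v L T (insert {v, u} P) t"
      using s F by (auto simp: lossy_def)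
    then show "?Q Y (insert {v, u} F) v" by blast
  next
    fix Y1 Y2 F1 F2 v
    assume F: "finite F1" "finite F2" "F1 \<inter> F2 = {}" and "?Q Y1 F1 v" "?Q Y2 F2 v"
    then obtain L1 T1 P1 t1 L2 T2 P2 t2
      where s: "lossy c Y1 F1 v L1 T1 P1 t1" "lossy c Y2 F2 v L2 T2 P2 t2" by auto
    show "?Q (Y1 \<union> Y2) (F1 \<union> F2) v"
    proof (cases "sum c P1 \<le> sum c P2")
      case True
      then show ?thesis using lossy_merge_aux[OF c F s] by blast
    next
      case False
      then have "?Q (Y2 \<union> Y1) (F2 \<union> F1) v"
        using lossy_merge_aux[OF c F(2,1) _ s(2,1)] F(3) by (metis Int_commute linear)
      then show ?thesis by (simp add: Un_commute)
    qed
  next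
    fix Y F F' v
    assume F: "finite F'" "F \<subseteq> F'" and "?Q Y F v"
    then obtain L T P t where s: "lossy c Y F v L T P t" by auto
    have "sum c F \<le> sum c F'" using F c by (intro sum_mono2) auto
    moreover have "T \<subseteq> links Y F' L"
      using s links_mono[of Y Y F F' L L] F by (auto simp: lossy_def)
    ultimately have "lossy c Y F' v L T P t" using s F by (auto simp: lossy_def)
    then show "?Q Y F' v" by blast
  qed (use assms in auto)
  moreover have "X \<inter> W = X" using assms by auto
  ultimately obtain L T P t where s: "lossy c X F v L T P t" by auto
  have "0 \<le> sum c P" using c by (simp add: sum_nonneg)
  then show ?thesis using s that[of L T] by (auto simp: lossy_def)
qed

section \<open>Doubling a tree\<close>

text \<open>Every edge may be paid for twice, and the pendant path \<open>P\<close> keeps both its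
  copies in reserve. The links rely on no edges bought beforehand.\<close>

definition doubled :: "('a set \<Rightarrow> real) \<Rightarrow> 'a set \<Rightarrow> 'a set set \<Rightarrow> 'a \<Rightarrow>
    ('a set \<times> 'a set set) set \<Rightarrow> 'a set set \<Rightarrow> 'a \<Rightarrow> bool" where
  "doubled c X F v T P t \<longleftrightarrow> P \<subseteq> F \<and> finite T \<and> T \<subseteq> links X F {} \<and> spans T X
     \<and> t \<in> X \<and> (v, t) \<in> (adj P)\<^sup>* \<and> sum (link_cost c) T + 2 * sum c P \<le> 2 * sum c F"

text \<open>The new link uses one copy of each pendant path. The cheaper path stays pendant, and its
  second copy is restored from that of the other path.\<close>

lemma doubled_merge_aux:
  assumes c: "\<And>e. 0 \<le> c e" and "finite F1" "finite F2" "F1 \<inter> F2 = {}"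
    and 1: "doubled c X1 F1 v T1 P1 t1" and 2: "doubled c X2 F2 v T2 P2 t2"
    and le: "sum c P1 \<le> sum c P2"
  shows "doubled c (X1 \<union> X2) (F1 \<union> F2) v (insert ({t1, t2}, P1 \<union> P2) (T1 \<union> T2)) P1 t1"
proof -
  have fin: "finite P1" "finite P2" "finite T1" "finite T2"
    using 1 2 assms(2,3) by (auto simp: doubled_def intro: finite_subset)
  let ?T = "insert ({t1, t2}, P1 \<union> P2) (T1 \<union> T2)"
  have "(t1, v) \<in> (adj (P1 \<union> P2))\<^sup>*"
    by (rule adj_rtrancl_mono[OF adj_rtrancl_sym, of _ _ P1]) (use 1 in \<open>auto simp: doubled_def\<close>)
  moreover have "(v, t2) \<in> (adj (P1 \<union> P2))\<^sup>*"
    by (rule adj_rtrancl_mono[of _ _ P2]) (use 2 in \<open>auto simp: doubled_def\<close>)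
  ultimately have "(t1, t2) \<in> (adj (P1 \<union> P2))\<^sup>*" by (rule rtrancl_trans)
  then have "({t1, t2}, P1 \<union> P2) \<in> links (X1 \<union> X2) (F1 \<union> F2) {}"
    using 1 2 unfolding links_def doubled_def by auto
  moreover have "T1 \<subseteq> links (X1 \<union> X2) (F1 \<union> F2) {}"
    using 1 links_mono[of X1 "X1 \<union> X2" F1 "F1 \<union> F2" "{}" "{}"] by (auto simp: doubled_def)
  moreover have "T2 \<subseteq> links (X1 \<union> X2) (F1 \<union> F2) {}"
    using 2 links_mono[of X2 "X1 \<union> X2" F2 "F1 \<union> F2" "{}" "{}"] by (auto simp: doubled_def)
  ultimately have T: "?T \<subseteq> links (X1 \<union> X2) (F1 \<union> F2) {}" by auto
  have sp: "spans ?T (X1 \<union> X2)" by (rule spans_join) (use 1 2 in \<open>auto simp: doubled_def\<close>)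
  have sT: "sum (link_cost c) ?T \<le> sum c P1 + sum c P2 + sum (link_cost c) T1 + sum (link_cost c) T2"
    using sum_insert_le[of "link_cost c" "T1 \<union> T2" "({t1, t2}, P1 \<union> P2)", OF link_cost_nonneg[OF c]]
      sum_Un_le[of "link_cost c" T1 T2, OF link_cost_nonneg[OF c]]
      sum_Un_le[of c P1 P2, OF c] fin
    by (simp add: link_cost_def[of c "({t1, t2}, P1 \<union> P2)"])
  have sF: "sum c (F1 \<union> F2) = sum c F1 + sum c F2" using assms(2-4) by (rule sum.union_disjoint)
  have "P1 \<subseteq> F1 \<union> F2" "t1 \<in> X1 \<union> X2" using 1 2 by (auto simp: doubled_def)
  then show ?thesis
    using T sp sT sF le 1 2 fin by (simp add: doubled_def)
qed

lemma double_tree: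
  assumes c: "\<And>e. 0 \<le> c e" and "rtree v W F" "X \<subseteq> W" "X \<noteq> {}"
  obtains T where "finite T" "T \<subseteq> links X F {}" "spans T X" "sum (link_cost c) T \<le> 2 * sum c F"
proof -
  let ?Q = "\<lambda>X F v. \<exists>T P t. doubled c X F v T P t"
  have "?Q (X \<inter> W) F v"
  proof (rule rtree_terminal_induct[OF assms(2), where Q = ?Q])
    fix v :: 'a
    have "doubled c {v} {} v {} {} v" by (auto simp: doubled_def spans_def)
    then show "?Q {v} {} v" by blast
  next
    fix Y and F :: "'a set set" and u v
    assume F: "finite F" "?Q Y F u" "{v, u} \<notin> F"
    then obtain T P t where s: "doubled c Y F u T P t" by auto
    have "finite P" "{v, u} \<notin> P" using s F by (auto simp: doubled_def intro: finite_subset)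
    moreover have "T \<subseteq> links Y (insert {v, u} F) {}"
      using s links_mono[of Y Y F "insert {v, u} F" "{}" "{}"] by (auto simp: doubled_def)
    moreover have "(v, t) \<in> (adj (insert {v, u} P))\<^sup>*"
    proof (rule converse_rtrancl_into_rtrancl)
      show "(v, u) \<in> adj (insert {v, u} P)" by (simp add: adj_def)
      show "(u, t) \<in> (adj (insert {v, u} P))\<^sup>*"
        by (rule adj_rtrancl_mono[of _ _ P]) (use s in \<open>auto simp: doubled_def\<close>)
    qed
    ultimately have "doubled c Y (insert {v, u} F) v T (insert {v, u} P) t"
      using s F by (auto simp: doubled_def)
    then show "?Q Y (insert {v, u} F) v" by blast
  next
    fix Y1 Y2 F1 F2 v
    assume F: "finite F1" "finite F2" "F1 \<inter> F2 = {}" and "?Q Y1 F1 v" "?Q Y2 F2 v"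
    then obtain T1 P1 t1 T2 P2 t2
      where s: "doubled c Y1 F1 v T1 P1 t1" "doubled c Y2 F2 v T2 P2 t2" by auto
    show "?Q (Y1 \<union> Y2) (F1 \<union> F2) v"
    proof (cases "sum c P1 \<le> sum c P2")
      case True
      then show ?thesis using doubled_merge_aux[OF c F s] by blast
    next
      case False
      then have "?Q (Y2 \<union> Y1) (F2 \<union> F1) v"
        using doubled_merge_aux[OF c F(2,1) _ s(2,1)] F(3) by (metis Int_commute linear)
      then show ?thesis by (simp add: Un_commute)
    qed
  next
    fix Y F F' v
    assume F: "finite F'" "F \<subseteq> F'" and "?Q Y F v"
    then obtain T P t where s: "doubled c Y F v T P t" by auto
    have "sum c F \<le> sum c F'" using F c by (intro sum_mono2) auto
    moreover have "T \<subseteq> links Y F' {}"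
      using s links_mono[of Y Y F F' "{}" "{}"] F by (auto simp: doubled_def)
    ultimately have "doubled c Y F' v T P t" using s F by (auto simp: doubled_def)
    then show "?Q Y F' v" by blast
  qed (use assms in auto)
  moreover have "X \<inter> W = X" using assms by auto
  ultimately obtain T P t where s: "doubled c X F v T P t" by auto
  have "0 \<le> sum c P" using c by (simp add: sum_nonneg)
  then show ?thesis using s that[of T] by (auto simp: doubled_def)
qed

section \<open>Iterated loss contraction\<close>

lemma links_elem:
  assumes "l \<in> T" "T \<subseteq> links R E F"
  shows "snd l \<subseteq> E" "\<exists>u\<in>R. \<exists>v\<in>R. fst l = {u, v}"
    "\<exists>u\<in>R. \<exists>v\<in>R. fst l = {u, v} \<and> (u, v) \<in> (adj (snd l \<union> F))\<^sup>*"
  using subsetD[OF assms(2,1)] unfolding links_def by fastforce+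

text \<open>Buying \<open>F\<close> and all edges that pay for links realizes every link as a path
  in the graph.\<close>

lemma clique_subset_adj:
  assumes "T \<subseteq> links R E F" "F \<union> \<Union>(snd ` T) \<subseteq> U"
  shows "cliques fst T \<subseteq> (adj U)\<^sup>*"
proof -
  have "N \<times> N \<subseteq> (adj U)\<^sup>*" if ND: "(N, D) \<in> T" for N D
  proof -
    obtain u v where uv: "N = {u, v}" "(u, v) \<in> (adj (D \<union> F))\<^sup>*"
      using links_elem(3)[OF ND assms(1)] by auto
    have "D \<subseteq> U" "F \<subseteq> U" using ND assms(2) by force+
    then have "(u, v) \<in> (adj U)\<^sup>*" using adj_rtrancl_mono[OF uv(2), of U] by auto
    then show ?thesis using uv adj_rtrancl_sym by auto
  qed
  then show ?thesis unfolding cliques_def by force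
qed

lemma sum_Union_le:
  assumes c: "\<And>e. 0 \<le> c e" and "finite T" "\<And>l. l \<in> T \<Longrightarrow> finite (snd l)"
  shows "sum c (\<Union>(snd ` T)) \<le> sum (link_cost c) T"
  using assms(2,3)
proof (induction T)
  case (insert l T)
  have "sum c (snd l \<union> \<Union>(snd ` T)) \<le> sum c (snd l) + sum c (\<Union>(snd ` T))"
    using insert by (intro sum_Un_le c) auto
  then show ?case using insert by (simp add: link_cost_def)
qed simp

text \<open>Loss contraction: \<open>L K\<close> is bought and \<open>S K\<close> becomes available as links. The component to
  contract is found by averaging: \<open>K\<close> has weight \<open>x K / M\<close>, doing nothing has the remaining weight.\<close>

lemma loss_contraction:
  fixes c :: "'a set \<Rightarrow> real" and M :: real
  assumes c: "\<And>e. 0 \<le> c e" and fR: "finite R" "R \<noteq> {}" and fE: "finite E"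
    and feas: "lp_feasible V E R x"
    and M: "1 \<le> M" "sum x (comps V E R) < M"
    and comp: "\<And>K. K \<in> comps V E R \<Longrightarrow>
      L K \<subseteq> E \<and> finite (S K) \<and> S K \<subseteq> links R E (L K) \<and> spans (S K) K"
    and T: "finite T" "T \<subseteq> links R E F" "spans T R" "F \<subseteq> E"
  shows "\<exists>U\<subseteq>E. R \<times> R \<subseteq> (adj U)\<^sup>* \<and>
    sum c U \<le> sum c F + (1 - 1 / M) ^ n * sum (link_cost c) T
      + (1 - (1 - 1 / M) ^ n) * (\<Sum>K\<in>comps V E R. x K * sum (link_cost c) (S K))
      + n / M * (\<Sum>K\<in>comps V E R. x K * sum c (L K))"
  using T
proof (induction n arbitrary: T F)
  case 0
  \<comment> \<open>With no steps left, the edges paying for all current links are bought.\<close>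
  let ?U = "F \<union> \<Union>(snd ` T)"
  have sub: "snd l \<subseteq> E" if "l \<in> T" for l using links_elem(1)[OF that 0(2)] .
  then have U: "?U \<subseteq> E" using 0 by auto
  have "(cliques fst T)\<^sup>* \<subseteq> (adj ?U)\<^sup>*"
    using clique_subset_adj[OF 0(2) order_refl] by (rule rtrancl_subset_rtrancl)
  then have "R \<times> R \<subseteq> (adj ?U)\<^sup>*" using 0 by (auto simp: spans_def)
  moreover have "sum c ?U \<le> sum c F + sum c (\<Union>(snd ` T))"
    using U fE by (intro sum_Un_le c) (auto intro: finite_subset)
  moreover have "sum c (\<Union>(snd ` T)) \<le> sum (link_cost c) T"
    using 0 finite_subset[OF sub fE] by (intro sum_Union_le c) auto
  ultimately show ?case using U by (intro exI[of _ ?U]) auto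
next
  case (Suc n)
  let ?C = "comps V E R"
  define q where "q = 1 - 1 / M"
  define Q where "Q = q ^ n"
  define ls where "ls = (\<Sum>K\<in>?C. x K * sum c (L K))"
  define lc where "lc = (\<Sum>K\<in>?C. x K * sum (link_cost c) (S K))"
  let ?w = "sum (link_cost c)"
  \<comment> \<open>The bound claimed for \<open>Suc n\<close> steps; each step multiplies the
    weight of the initial links by \<open>q\<close>.\<close>
  define \<beta> where "\<beta> = sum c F + q ^ Suc n * ?w T + (1 - q ^ Suc n) * lc + Suc n / M * ls"
  have q: "0 \<le> q" "M * q = M - 1" using M by (auto simp: q_def field_simps)
  have Q: "0 \<le> Q" using q by (simp add: Q_def)
  have x0: "0 \<le> x K" if "K \<in> ?C" for K using feas that by (simp add: lp_feasible_def)
  have ends: "\<exists>u\<in>R. \<exists>v\<in>R. fst l = {u, v}" if "l \<in> T" for l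
    using links_elem(2)[OF that Suc.prems(2)] .
  obtain B0 B where B0: "B0 \<subseteq> T" "R \<times> R \<subseteq> (cliques fst B0)\<^sup>*"
    and "\<forall>K\<in>?C. B K \<subseteq> T \<and> R \<times> R \<subseteq> (K \<times> K \<union> cliques fst (B K))\<^sup>*"
    and br: "?w B0 \<le> (\<Sum>K\<in>?C. x K * (?w B0 - ?w (B K)))"
    by (rule bridge[where w = "link_cost c", OF fR feas Suc.prems(1) ends link_cost_nonneg[where c = c, OF c] Suc.prems(3)[unfolded spans_def]])
  then have B: "B K \<subseteq> T" "R \<times> R \<subseteq> (K \<times> K \<union> cliques fst (B K))\<^sup>*" if "K \<in> ?C" for K
    using that by blast+
  have w0: "?w B0 \<le> ?w T" using B0 Suc.prems(1) link_cost_nonneg[OF c] by (intro sum_mono2) auto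
  show ?case
  proof (rule ccontr)
    \<comment> \<open>If the bound fails, then every option for the first step, continued by the
      induction hypothesis, leads to a bound above \<open>\<beta>\<close>; so does their weighted
      average, which will be seen to be at most \<open>\<beta>\<close>.\<close>
    assume "\<not> ?case"
    then have no: "\<beta> < sum c U" if "U \<subseteq> E" "R \<times> R \<subseteq> (adj U)\<^sup>*" for U
      using that unfolding \<beta>_def q_def lc_def ls_def by (meson not_le)
    have IH: "\<beta> < sum c F' + Q * ?w T' + (1 - Q) * lc + n / M * ls"
      if T': "finite T'" "T' \<subseteq> links R E F'" "spans T' R" "F' \<subseteq> E" for T' F'
    proof -
      obtain U where U: "U \<subseteq> E" "R \<times> R \<subseteq> (adj U)\<^sup>*"
        "sum c U \<le> sum c F' + Q * ?w T' + (1 - Q) * lc + n / M * ls"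
        using Suc.IH[OF T'] unfolding Q_def q_def lc_def ls_def by blast
      then show ?thesis using no[OF U(1,2)] by linarith
    qed
    define \<rho> where "\<rho> = (1 - Q) * lc + n / M * ls"
    \<comment> \<open>Doing nothing still replaces \<open>T\<close> by the greedy set
      \<open>B0\<close>.\<close>
    have stay: "\<beta> < sum c F + Q * ?w B0 + \<rho>"
      using IH[of B0 F] B0(2) subset_trans[OF B0(1) Suc.prems(2)] Suc.prems(4)
        finite_subset[OF B0(1) Suc.prems(1)] by (simp add: spans_def \<rho>_def)
    \<comment> \<open>Contracting \<open>K\<close>: \<open>L K\<close> is bought, and
      \<open>S K\<close> takes over connecting \<open>K\<close>, so that only \<open>B K\<close> has
      to be kept.\<close>
    have contract: "\<beta> \<le> sum c F + sum c (L K) + Q * (?w (B K) + ?w (S K)) + \<rho>" if K: "K \<in> ?C" for K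
    proof -
      have fin: "finite (B K)" "finite (S K)" using comp[OF K] finite_subset[OF B(1)[OF K] Suc.prems(1)] by auto
      have "B K \<union> S K \<subseteq> links R E (F \<union> L K)"
        using links_mono[of R R E E F "F \<union> L K"] links_mono[of R R E E "L K" "F \<union> L K"]
          comp[OF K] B(1)[OF K] Suc.prems(2) by auto
      moreover have "K \<times> K \<union> cliques fst (B K) \<subseteq> (cliques fst (B K \<union> S K))\<^sup>*"
        using spans_mono[of "S K" K "B K \<union> S K"] comp[OF K] by (auto simp: spans_def cliques_Un)
      then have "(K \<times> K \<union> cliques fst (B K))\<^sup>* \<subseteq> (cliques fst (B K \<union> S K))\<^sup>*"
        by (rule rtrancl_subset_rtrancl)
      then have "spans (B K \<union> S K) R" using B(2)[OF K] by (auto simp: spans_def)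
      ultimately have "\<beta> < sum c (F \<union> L K) + Q * ?w (B K \<union> S K) + \<rho>"
        using IH[of "B K \<union> S K" "F \<union> L K"] fin comp[OF K] Suc.prems(4) by (auto simp: \<rho>_def)
      moreover have "sum c (F \<union> L K) \<le> sum c F + sum c (L K)"
        using comp[OF K] Suc.prems(4) fE by (intro sum_Un_le c) (auto intro: finite_subset)
      moreover have "Q * ?w (B K \<union> S K) \<le> Q * (?w (B K) + ?w (S K))"
        using fin Q by (intro mult_left_mono sum_Un_le link_cost_nonneg c) auto
      ultimately show ?thesis by linarith
    qed
    define X where "X = sum x ?C"
    have "X * \<beta> = (\<Sum>K\<in>?C. x K * \<beta>)" by (simp add: X_def sum_distrib_right)
    also have "\<dots> \<le> (\<Sum>K\<in>?C. x K * (sum c F + sum c (L K) + Q * (?w (B K) + ?w (S K)) + \<rho>))"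
      using contract x0 by (intro sum_mono mult_left_mono) auto
    also have "\<dots> = X * (sum c F + \<rho>) + ls + Q * (\<Sum>K\<in>?C. x K * ?w (B K)) + Q * lc"
      by (simp add: X_def ls_def lc_def sum_distrib_left sum_distrib_right sum.distrib[symmetric] algebra_simps)
    finally have 1: "X * \<beta> \<le> X * (sum c F + \<rho>) + ls + Q * (\<Sum>K\<in>?C. x K * ?w (B K)) + Q * lc" .
    \<comment> \<open>Doing nothing has positive weight \<open>M - X\<close>, which makes the
      averaged inequality strict even if every \<open>x K\<close> is 0.\<close>
    have 2: "(M - X) * \<beta> < (M - X) * (sum c F + Q * ?w B0 + \<rho>)"
      using stay M(2) by (intro mult_strict_left_mono) (auto simp: X_def)
    have "(\<Sum>K\<in>?C. x K * (?w B0 - ?w (B K))) = X * ?w B0 - (\<Sum>K\<in>?C. x K * ?w (B K))"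
      by (simp add: X_def sum_distrib_right sum_subtractf right_diff_distrib)
    \<comment> \<open>By the bridge inequality the sets \<open>B K\<close> cost on total at most
      \<open>X - 1\<close> times \<open>B0\<close>. With the weight \<open>M - X\<close> of doing
      nothing, \<open>B0\<close> counts \<open>M - 1\<close> times.\<close>
    then have "Q * (\<Sum>K\<in>?C. x K * ?w (B K)) \<le> Q * (X * ?w B0 - ?w B0)"
      using br Q by (intro mult_left_mono) auto
    then have "M * \<beta> < M * (sum c F + \<rho>) + ls + Q * ((M - 1) * ?w B0 + lc)"
      using 1 2 by (simp add: algebra_simps)
    also have "\<dots> \<le> M * (sum c F + \<rho>) + ls + Q * ((M - 1) * ?w T + lc)"
      using w0 Q M by (intro add_left_mono mult_left_mono add_right_mono) auto
    also have "\<dots> = M * \<beta>"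
    proof -
      have "M * (n / M * ls) = n * ls" "M * (Suc n / M * ls) = Suc n * ls" using M by auto
      moreover have e: "M * q ^ Suc n = Q * (M - 1)" unfolding q(2)[symmetric] by (simp add: Q_def)
      have "M * (q ^ Suc n * ?w T) = (M * q ^ Suc n) * ?w T" by (simp only: mult.assoc)
      moreover have "M * ((1 - q ^ Suc n) * lc) = M * lc - (M * q ^ Suc n) * lc"
        by (simp only: left_diff_distrib right_diff_distrib mult_1 mult.assoc)
      ultimately have "M * \<beta> = M * sum c F + Q * (M - 1) * ?w T + (M * lc - Q * (M - 1) * lc) + Suc n * ls"
        unfolding \<beta>_def distrib_left e by linarith
      moreover have "M * \<rho> = M * lc - M * Q * lc + n * ls"
        using M unfolding \<rho>_def by (simp add: distrib_left left_diff_distrib right_diff_distrib)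
      ultimately show ?thesis by (simp add: algebra_simps)
    qed
    finally show False by simp
  qed
qed

section \<open>Optimal components and the initial links\<close>

text \<open>There are finitely many edge sets, so the infimum \<open>CK\<close> is attained; a
  spanning \<open>rtree\<close> of an optimal component opens it to the recursions on rooted
  trees.\<close>

lemma optimal_component:
  assumes c: "\<And>e. 0 \<le> c e" and g: "graph V E" and K: "K \<in> comps V E R"
  obtains v W F where "F \<subseteq> E" "rtree v W F" "K \<subseteq> W" "sum c F \<le> CK V E c R K"
proof -
  let ?X = "{tree_cost c F | W F. full_component V E R K W F}"
  have "E \<subseteq> Pow V" "finite V" using g by (auto simp: graph_def)
  then have "finite E" by (auto intro: finite_subset)
  then have "finite ?X"
    by (intro finite_subset[of ?X "tree_cost c ` Pow E"]) (auto simp: full_component_def is_tree_def)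
  moreover have "?X \<noteq> {}" using K by (auto simp: comps_def)
  ultimately have "Inf ?X \<in> ?X" using Min_in[of ?X] cInf_eq_Min[of ?X] by simp
  then obtain W F where F: "full_component V E R K W F" "CK V E c R K = tree_cost c F"
    by (auto simp: CK_def)
  then have t: "is_tree V E W F" and KW: "K \<subseteq> W" by (auto simp: full_component_def leaves_def)
  then obtain v where v: "v \<in> W" by (auto simp: is_tree_def)
  have "finite W" using t \<open>finite V\<close> by (auto simp: is_tree_def intro: finite_subset)
  then obtain F' where F': "F' \<subseteq> F" "rtree v W F'"
    using spanning_rtree[of W v F] t v by (auto simp: is_tree_def connected_sub_def adj_def)
  have "F \<subseteq> E" using t by (auto simp: is_tree_def)
  then have "sum c F' \<le> sum c F" using F' c \<open>finite E\<close> by (intro sum_mono2) (auto intro: finite_subset)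
  then show ?thesis using that[of F' v W] F' F KW \<open>F \<subseteq> E\<close> by (auto simp: tree_cost_def)
qed

text \<open>For a cheapest spanning set \<open>T\<close> of links, replacing \<open>T\<close> by
  \<open>B K\<close> and the doubled component on \<open>K\<close> cannot lower the cost, so
  contracting \<open>K\<close> saves at most twice \<open>CK\<close>. The bridge inequality sums
  these savings.\<close>

lemma terminal_spanning_tree:
  fixes c :: "'a set \<Rightarrow> real"
  assumes c: "\<And>e. 0 \<le> c e" and g: "graph V E" and R: "finite R" "R \<noteq> {}"
    and feas: "lp_feasible V E R x"
  obtains T where "finite T" "T \<subseteq> links R E {}" "spans T R"
    "sum (link_cost c) T \<le> 2 * lp_obj V E c R x"
proof -
  let ?C = "comps V E R" and ?w = "sum (link_cost c)"
  have "E \<subseteq> Pow V" "finite V" using g by (auto simp: graph_def)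
  then have fE: "finite E" by (auto intro: finite_subset)
  have "links R E {} \<subseteq> Pow R \<times> Pow E" by (auto simp: links_def)
  then have fl: "finite (links R E {})" using R fE by (auto intro: finite_subset)
  have x0: "0 \<le> x K" if "K \<in> ?C" for K using feas that by (simp add: lp_feasible_def)
  have D: "\<exists>D. finite D \<and> D \<subseteq> links R E {} \<and> spans D K \<and> ?w D \<le> 2 * CK V E c R K" if K: "K \<in> ?C" for K
  proof -
    obtain v W F where F: "F \<subseteq> E" "rtree v W F" "K \<subseteq> W" "sum c F \<le> CK V E c R K"
      by (rule optimal_component[where c = c, OF c g K])
    have KR: "K \<subseteq> R" "K \<noteq> {}" using K by (auto simp: comps_def)
    obtain D where "finite D" "D \<subseteq> links K F {}" "spans D K" "?w D \<le> 2 * sum c F"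
      using double_tree[where c = c, OF c F(2,3) KR(2)] by metis
    then show ?thesis using F links_mono[of K R F E "{}" "{}"] KR by (intro exI[of _ D]) auto
  qed
  define A where "A = cliques fst (links R E {})"
  have sA: "sym A" unfolding A_def by (rule sym_cliques)
  \<comment> \<open>Each component lies in one class of the relation given by all links, so the
    right side is 0 and there is only one class: the links do connect the terminals.\<close>
  have "real (card (comp_of A ` R)) - 1 \<le> (\<Sum>K\<in>?C. x K * (real (card (comp_of A ` K)) - 1))"
    by (rule partition_inequality[OF R(1) feas])
  also have "\<dots> = 0"
  proof (rule sum.neutral, rule ballI)
    fix K assume K: "K \<in> ?C"
    then have "spans (links R E {}) K" using D[OF K] spans_mono by metis
    then have "ncomps K A = 1"
      using K by (intro ncomps_connected sA) (auto simp: spans_def A_def comps_def)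
    then show "x K * (real (card (comp_of A ` K)) - 1) = 0" by (simp add: ncomps_def)
  qed
  finally have "card (comp_of A ` R) \<le> Suc 0" by simp
  then have "comp_of A a = comp_of A b" if "a \<in> R" "b \<in> R" for a b
    using that card_le_Suc0_iff_eq[OF finite_imageI[OF R(1)], of "comp_of A"] by blast
  then have sl: "spans (links R E {}) R"
    unfolding spans_def using comp_of_eq_iff[OF sA] A_def by auto
  let ?T = "{T. T \<subseteq> links R E {} \<and> spans T R}"
  have "finite ?T" "?T \<noteq> {}" using fl sl by auto
  from ex_is_arg_min_if_finite[OF this, of ?w] obtain T where "is_arg_min ?w (\<lambda>T. T \<in> ?T) T" ..
  then have T: "T \<subseteq> links R E {}" "spans T R" and
    mn: "\<And>T'. T' \<subseteq> links R E {} \<Longrightarrow> spans T' R \<Longrightarrow> ?w T \<le> ?w T'"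
    by (auto simp: is_arg_min_linorder)
  have fT: "finite T" using T fl finite_subset by auto
  have ends: "\<exists>u\<in>R. \<exists>v\<in>R. fst l = {u, v}" if "l \<in> T" for l
    using links_elem(2)[OF that T(1)] .
  obtain B0 B where B0: "B0 \<subseteq> T" "R \<times> R \<subseteq> (cliques fst B0)\<^sup>*"
    and "\<forall>K\<in>?C. B K \<subseteq> T \<and> R \<times> R \<subseteq> (K \<times> K \<union> cliques fst (B K))\<^sup>*"
    and br: "?w B0 \<le> (\<Sum>K\<in>?C. x K * (?w B0 - ?w (B K)))"
    by (rule bridge[where w = "link_cost c", OF R feas fT ends link_cost_nonneg[where c = c, OF c] T(2)[unfolded spans_def]])
  then have B: "B K \<subseteq> T" "R \<times> R \<subseteq> (K \<times> K \<union> cliques fst (B K))\<^sup>*" if "K \<in> ?C" for K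
    using that by blast+
  have w0: "?w B0 \<le> ?w T" using B0 fT link_cost_nonneg[OF c] by (intro sum_mono2) auto
  \<comment> \<open>\<open>B0\<close> spans as well, so minimality carries the bound for
    \<open>B0\<close> over to \<open>T\<close>.\<close>
  have w1: "?w T \<le> ?w B0" using B0 T by (intro mn) (auto simp: spans_def)
  have "?w B0 - ?w (B K) \<le> 2 * CK V E c R K" if K: "K \<in> ?C" for K
  proof -
    obtain D where D: "finite D" "D \<subseteq> links R E {}" "spans D K" "?w D \<le> 2 * CK V E c R K"
      using D[OF K] by auto
    have "K \<times> K \<union> cliques fst (B K) \<subseteq> (cliques fst (B K \<union> D))\<^sup>*"
      using spans_mono[of D K "B K \<union> D"] D by (auto simp: spans_def cliques_Un)
    then have "(K \<times> K \<union> cliques fst (B K))\<^sup>* \<subseteq> (cliques fst (B K \<union> D))\<^sup>*"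
      by (rule rtrancl_subset_rtrancl)
    then have "spans (B K \<union> D) R" using B(2)[OF K] by (auto simp: spans_def)
    then have "?w T \<le> ?w (B K \<union> D)" using B(1)[OF K] T D by (intro mn) auto
    also have "\<dots> \<le> ?w (B K) + ?w D"
      using D B(1)[OF K] fT by (intro sum_Un_le link_cost_nonneg c) (auto intro: finite_subset)
    finally show ?thesis using D w0 by simp
  qed
  then have "(\<Sum>K\<in>?C. x K * (?w B0 - ?w (B K))) \<le> (\<Sum>K\<in>?C. x K * (2 * CK V E c R K))"
    using x0 by (intro sum_mono mult_left_mono) auto
  also have "\<dots> = 2 * lp_obj V E c R x"
    by (simp add: lp_obj_def sum_distrib_left mult.commute mult.left_commute)
  finally show ?thesis using that[of T] fT T br w1 by linarith
qed

section \<open>Choice of the parameters\<close>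

lemma ln_3_ge_1: "1 \<le> ln (3 :: real)"
  using exp_le by (simp add: ln_ge_iff)

text \<open>The choice of \<open>ln 3\<close>: with \<open>t = n / M\<close>, \<open>q\<close> close
  to \<open>exp (- t)\<close> and a loss of half the LP value, the bound is
  \<open>1 / 2 + 3 * q / 2 + t / 2\<close> times that value, which is least at
  \<open>q = 1 / 3\<close>.\<close>

lemma cheap_connection:
  fixes c :: "'a set \<Rightarrow> real"
  assumes c: "\<And>e. 0 \<le> c e" and g: "graph V E" and R: "finite R" "R \<noteq> {}"
    and feas: "lp_feasible V E R x"
  shows "\<exists>U\<subseteq>E. R \<times> R \<subseteq> (adj U)\<^sup>* \<and> sum c U \<le> (1 + ln 3 / 2) * lp_obj V E c R x"
proof -
  let ?C = "comps V E R" and ?w = "sum (link_cost c)"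
  define lp where "lp = lp_obj V E c R x"
  have "E \<subseteq> Pow V" "finite V" using g by (auto simp: graph_def)
  then have fE: "finite E" by (auto intro: finite_subset)
  have x0: "0 \<le> x K" if "K \<in> ?C" for K using feas that by (simp add: lp_feasible_def)
  have "\<forall>K\<in>?C. \<exists>L S. L \<subseteq> E \<and> finite S \<and> S \<subseteq> links R E L \<and> spans S K
    \<and> sum c L + ?w S \<le> CK V E c R K \<and> 2 * sum c L \<le> CK V E c R K"
  proof
    fix K assume K: "K \<in> ?C"
    obtain v W F where F: "F \<subseteq> E" "rtree v W F" "K \<subseteq> W" "sum c F \<le> CK V E c R K"
      by (rule optimal_component[where c = c, OF c g K])
    have KR: "K \<subseteq> R" "K \<noteq> {}" using K by (auto simp: comps_def)
    obtain L S where "L \<subseteq> F" "finite S" "S \<subseteq> links K F L" "spans S K"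
      "sum c L + ?w S \<le> sum c F" "2 * sum c L \<le> sum c F"
      using loss_decomposition[where c = c, OF c F(2,3) KR(2)] by metis
    then show "\<exists>L S. L \<subseteq> E \<and> finite S \<and> S \<subseteq> links R E L \<and> spans S K
      \<and> sum c L + ?w S \<le> CK V E c R K \<and> 2 * sum c L \<le> CK V E c R K"
      using F links_mono[of K R F E L L] KR by (intro exI[of _ L] exI[of _ S]) auto
  qed
  then obtain L S where LS: "\<And>K. K \<in> ?C \<Longrightarrow> L K \<subseteq> E \<and> finite (S K) \<and> S K \<subseteq> links R E (L K) \<and> spans (S K) K"
    and cost: "\<And>K. K \<in> ?C \<Longrightarrow> sum c (L K) + ?w (S K) \<le> CK V E c R K"
      "\<And>K. K \<in> ?C \<Longrightarrow> 2 * sum c (L K) \<le> CK V E c R K"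
    by metis
  define ls where "ls = (\<Sum>K\<in>?C. x K * sum c (L K))"
  define lc where "lc = (\<Sum>K\<in>?C. x K * ?w (S K))"
  have "ls + lc = (\<Sum>K\<in>?C. x K * (sum c (L K) + ?w (S K)))"
    by (simp add: ls_def lc_def sum.distrib distrib_left)
  also have "\<dots> \<le> (\<Sum>K\<in>?C. x K * CK V E c R K)" using x0 cost by (intro sum_mono mult_left_mono) auto
  finally have le1: "ls + lc \<le> lp" by (simp add: lp_def lp_obj_def mult.commute)
  have "2 * ls = (\<Sum>K\<in>?C. x K * (2 * sum c (L K)))" by (simp add: ls_def sum_distrib_left mult.left_commute)
  also have "\<dots> \<le> (\<Sum>K\<in>?C. x K * CK V E c R K)" using x0 cost by (intro sum_mono mult_left_mono) auto
  finally have le2: "2 * ls \<le> lp" by (simp add: lp_def lp_obj_def mult.commute)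
  have ls0: "0 \<le> ls" unfolding ls_def using x0 c by (intro sum_nonneg mult_nonneg_nonneg) auto
  obtain T where T: "finite T" "T \<subseteq> links R E {}" "spans T R" "?w T \<le> 2 * lp"
    using terminal_spanning_tree[where c = c, OF c g R feas] unfolding lp_def by metis
  \<comment> \<open>A large \<open>n\<close> lets \<open>M\<close> exceed both 1 and the total
    weight of the components while \<open>n / M\<close> stays equal to \<open>ln 3\<close>.\<close>
  obtain n :: nat where n: "ln 3 * (\<bar>sum x ?C\<bar> + 1) < real n" using reals_Archimedean2 by blast
  define M where "M = n / ln 3"
  have nM: "n / M = ln 3" "M > \<bar>sum x ?C\<bar> + 1"
  proof -
    have "0 < ln 3 * (\<bar>sum x ?C\<bar> + 1)" using ln_3_ge_1 by (intro mult_pos_pos) auto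
    then have "0 < real n" using n by linarith
    then show "n / M = ln 3" unfolding M_def by simp
    show "M > \<bar>sum x ?C\<bar> + 1" using n ln_3_ge_1 unfolding M_def by (simp add: pos_less_divide_eq mult.commute)
  qed
  then have M: "1 \<le> M" "sum x ?C < M" by auto
  define q where "q = (1 - 1 / M) ^ n"
  have q0: "0 \<le> q" using M by (auto simp: q_def)
  have "1 - 1 / M \<le> exp (- (1 / M))" using exp_ge_add_one_self[of "- (1 / M)"] by simp
  then have "q \<le> exp (- (1 / M)) ^ n" unfolding q_def using M by (intro power_mono) auto
  also have "\<dots> = exp (- (n / M))" by (simp add: exp_of_nat_mult[symmetric])
  also have "\<dots> = 1 / 3" using nM by (simp add: exp_minus inverse_eq_divide)
  finally have q1: "q \<le> 1 / 3" .
  obtain U where U: "U \<subseteq> E" "R \<times> R \<subseteq> (adj U)\<^sup>*"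
    "sum c U \<le> sum c {} + q * ?w T + (1 - q) * lc + n / M * ls"
    using loss_contraction[where c = c, OF c R fE feas M LS T(1-3), of n] unfolding q_def lc_def ls_def by auto
  have "q * ?w T \<le> q * (2 * lp)" using q0 T by (intro mult_left_mono) auto
  moreover have "(1 - q) * lc \<le> (1 - q) * (lp - ls)" using q1 le1 by (intro mult_left_mono) auto
  ultimately have "sum c U \<le> q * (2 * lp) + (1 - q) * (lp - ls) + ln 3 * ls" using U(3) nM by simp
  also have "\<dots> = q * (lp + ls) + (lp - ls) + ln 3 * ls" by (simp add: algebra_simps)
  \<comment> \<open>The bound grows with \<open>q\<close> and, since
    \<open>ln 3 \<ge> 2 / 3\<close>, with \<open>ls\<close>; the extremes \<open>q = 1 / 3\<close>
    and \<open>ls = lp / 2\<close> are inserted in turn.\<close>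
  also have "\<dots> \<le> 1 / 3 * (lp + ls) + (lp - ls) + ln 3 * ls"
    using q1 ls0 le2 by (intro add_right_mono mult_right_mono) auto
  also have "\<dots> = 4 / 3 * lp + (ln 3 - 2 / 3) * ls" by (simp add: field_simps)
  also have "\<dots> \<le> 4 / 3 * lp + (ln 3 - 2 / 3) * (lp / 2)"
    using le2 ln_3_ge_1 by (intro add_left_mono mult_left_mono) auto
  also have "\<dots> = (1 + ln 3 / 2) * lp" by (simp add: field_simps)
  finally show ?thesis using U unfolding lp_def by blast
qed

section \<open>From connecting edge sets to Steiner trees\<close>

text \<open>The vertices reachable from one terminal through \<open>U\<close> include all terminals,
  and a spanning tree on them within \<open>U\<close> is a Steiner tree.\<close>

lemma OPT_le_connection:
  assumes c: "\<And>e. 0 \<le> c e" and g: "graph V E" and R: "R \<subseteq> V" "R \<noteq> {}"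
    and U: "U \<subseteq> E" "R \<times> R \<subseteq> (adj U)\<^sup>*"
  shows "OPT V E c R \<le> sum c U"
proof -
  obtain r where r: "r \<in> R" using R by auto
  define W where "W = {w \<in> V. (r, w) \<in> (adj U)\<^sup>*}"
  define F where "F = {e \<in> U. e \<subseteq> W}"
  have edge: "\<exists>u v. u \<in> V \<and> v \<in> V \<and> e = {u, v}" if "e \<in> E" for e
    using g that unfolding graph_def by metis
  have fV: "finite V" using g by (simp add: graph_def)
  have "E \<subseteq> Pow V" using edge by blast
  then have fU: "finite U" using fV U by (auto intro: finite_subset)
  \<comment> \<open>A path from \<open>r\<close> never leaves \<open>W\<close>, so the edges inside
    \<open>W\<close> suffice.\<close>
  have "(r, w) \<in> (adj F)\<^sup>*" if "(r, w) \<in> (adj U)\<^sup>*" for w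
    using that
  proof induction
    case (step y z)
    have "{y, z} \<in> U" using step by (simp add: adj_def)
    moreover have "y \<in> V" "z \<in> V" using \<open>E \<subseteq> Pow V\<close> \<open>{y, z} \<in> U\<close> U by auto
    moreover have "(r, z) \<in> (adj U)\<^sup>*" using step by (auto intro: rtrancl.rtrancl_into_rtrancl)
    ultimately have "(y, z) \<in> adj F" using step.hyps by (auto simp: F_def W_def adj_def)
    then show ?case using step.IH by (auto intro: rtrancl.rtrancl_into_rtrancl)
  qed simp
  then have reach: "\<And>w. w \<in> W \<Longrightarrow> (r, w) \<in> (adj F)\<^sup>*" by (auto simp: W_def)
  have "r \<in> W" "finite W" "\<And>e. e \<in> F \<Longrightarrow> e \<subseteq> W" using r R fV by (auto simp: W_def F_def)
  then obtain F' where F': "F' \<subseteq> F" "rtree r W F'"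
    using spanning_rtree[OF _ reach] by blast
  have "connected_sub W F'"
    unfolding connected_sub_def adj_def[symmetric]
    using rtree_connected[OF F'(2)] adj_rtrancl_sym by (meson rtrancl_trans)
  then have "is_tree V E W F'"
    using F' U rtree_card[OF F'(2)] \<open>r \<in> W\<close> by (auto simp: is_tree_def W_def F_def)
  moreover have "R \<subseteq> W" using R U r by (auto simp: W_def)
  ultimately have "steiner_tree V E R W F'" by (simp add: steiner_tree_def)
  then have "OPT V E c R \<le> tree_cost c F'"
    unfolding OPT_def
    by (intro cInf_lower) (auto intro!: bdd_belowI[of _ 0] sum_nonneg c simp: tree_cost_def)
  also have "\<dots> \<le> sum c U"
    unfolding tree_cost_def using F' fU c by (intro sum_mono2) (auto simp: F_def)
  finally show ?thesis .
qed

text \<open>Trees use edges of \<open>E\<close> only, so no other values of the cost function enter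
  the infima.\<close>

lemma cost_cong:
  assumes "\<And>e. e \<in> E \<Longrightarrow> c e = c' e"
  shows "OPT V E c R = OPT V E c' R" "CK V E c R K = CK V E c' R K" "lp_obj V E c R x = lp_obj V E c' R x"
proof -
  have tc: "tree_cost c F = tree_cost c' F" if "is_tree V E W F" for W F
    unfolding tree_cost_def using assms that by (intro sum.cong) (auto simp: is_tree_def)
  have "{tree_cost c F | W F. steiner_tree V E R W F} = {tree_cost c' F | W F. steiner_tree V E R W F}"
    using tc unfolding steiner_tree_def by metis
  then show "OPT V E c R = OPT V E c' R" by (simp add: OPT_def)
  have "{tree_cost c F | W F. full_component V E R K W F} = {tree_cost c' F | W F. full_component V E R K W F}" for K
    using tc unfolding full_component_def by metis
  then have "CK V E c R K = CK V E c' R K" for K by (simp add: CK_def)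
  then show "CK V E c R K = CK V E c' R K" "lp_obj V E c R x = lp_obj V E c' R x"
    by (simp_all add: lp_obj_def)
qed

theorem theorem1:
  fixes V :: "'a set" and E :: "'a set set" and c :: "'a set \<Rightarrow> real" and R :: "'a set"
  assumes "graph V E"
    and "\<forall>e\<in>E. c e \<ge> 0"
    and "R \<subseteq> V"
    and "\<exists>x. lp_feasible V E R x"
  shows "OPT V E c R \<le> (1 + ln 3 / 2) * LP_star V E c R"
proof -
  \<comment> \<open>The lemmas above ask for costs that are nonnegative on all sets; putting 0
    outside \<open>E\<close> achieves this.\<close>
  define c' where "c' e = (if e \<in> E then c e else 0)" for e
  have c': "0 \<le> c' e" for e using assms(2) by (simp add: c'_def)
  have eq: "c e = c' e" if "e \<in> E" for e using that by (simp add: c'_def)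
  have fR: "finite R" using assms(1,3) by (auto simp: graph_def intro: finite_subset)
  have pos: "0 < 1 + ln 3 / (2 :: real)" using ln_3_ge_1 by linarith
  \<comment> \<open>Dividing by the positive constant turns the claim into a lower bound for all LP
    values.\<close>
  have "OPT V E c R / (1 + ln 3 / 2) \<le> LP_star V E c R"
    unfolding LP_star_def
  proof (rule cInf_greatest)
    show "{lp_obj V E c R x | x. lp_feasible V E R x} \<noteq> {}" using assms(4) by auto
    fix y assume "y \<in> {lp_obj V E c R x | x. lp_feasible V E R x}"
    then obtain x where x: "y = lp_obj V E c R x" "lp_feasible V E R x" by auto
    \<comment> \<open>For empty \<open>R\<close> the spanning equation would read 0 = -1, so
      feasibility provides a terminal.\<close>
    have "comps V E {} = {}" by (auto simp: comps_def)
    then have "R \<noteq> {}" using x(2) by (auto simp: lp_feasible_def)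
    then obtain U where U: "U \<subseteq> E" "R \<times> R \<subseteq> (adj U)\<^sup>*"
      "sum c' U \<le> (1 + ln 3 / 2) * lp_obj V E c' R x"
      using cheap_connection[where c = c', OF c' assms(1) fR _ x(2)] by auto
    have "OPT V E c R \<le> (1 + ln 3 / 2) * y"
      using OPT_le_connection[where c = c', OF c' assms(1,3) \<open>R \<noteq> {}\<close> U(1,2)] U(3) x(1)
        cost_cong(1)[of E c c', OF eq] cost_cong(3)[of E c c', OF eq] by simp
    then show "OPT V E c R / (1 + ln 3 / 2) \<le> y" using pos by (simp add: pos_divide_le_eq mult.commute)
  qed
  then show ?thesis using pos by (simp add: pos_divide_le_eq mult.commute)
qed

end
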